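(* Let $H$ be a quasi-Hopf algebra with bijective antipode over a field $k$ of characteristic different from $2$. If $B$ is a $2$-dimensional Hopf algebra in the braided category ${}_H^H\mathcal{YD}$ of left Yetter-Drinfeld modules over $H$, then $B$ is isomorphic (as a Hopf algebra in ${}_H^H\mathcal{YD}$) either to one of the braided Hopf algebras $B_{\sigma,v}$, for some couple $(\sigma,v)$ consisting of an algebra map $\sigma:H\to k$ and an element $v\in H$ satisfying $\sigma(v)=-1$, $\varepsilon(v)=1$, $$\Delta(v)=\sigma(x^3X^2y^1)\,x^1X^1vy^2\otimes x^2vX^3y^3,\qquad \sigma(h_2)h_1v=\sigma(h_1)vh_2\ \text{ for all } h\in H,$$ or to the group Hopf algebra $k[C_2]$ of the cyclic group $C_2$ of order $2$, considered in ${}_H^H\mathcal{YD}$ via the trivial structure.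
   Context: Everything is over $k$; $\otimes=\otimes_k$. A quasi-bialgebra is $(H,\Delta,\varepsilon,\Phi)$ with $H$ a unital associative algebra, $\Phi\in H^{\otimes 3}$ invertible (the reassociator), $\Delta:H\to H\otimes H$ and $\varepsilon:H\to k$ algebra maps such that $(\mathrm{id}\otimes\Delta)\Delta(h)=\Phi\,(\Delta\otimes\mathrm{id})(\Delta(h))\,\Phi^{-1}$, $(\mathrm{id}\otimes\varepsilon)\Delta(h)=h=(\varepsilon\otimes\mathrm{id})\Delta(h)$, $(\mathrm{id}\otimes\varepsilon\otimes\mathrm{id})(\Phi)=1\otimes1$ and $(1\otimes\Phi)(\mathrm{id}\otimes\Delta\otimes\mathrm{id})(\Phi)(\Phi\otimes1)=(\mathrm{id}\otimes\mathrm{id}\otimes\Delta)(\Phi)(\Delta\otimes\mathrm{id}\otimes\mathrm{id})(\Phi)$. Write $\Delta(h)=h_1\otimes h_2$, $\Phi=X^1\otimes X^2\otimes X^3=Y^1\otimes Y^2\otimes Y^3$, $\Phi^{-1}=x^1\otimes x^2\otimes x^3=y^1\otimes y^2\otimes y^3$ (summation understood; different letters denote independent copies). $H$ is a quasi-Hopf algebra if there are an algebra anti-morphism $S:H\to H$ (antipode) and $\alpha,\beta\in H$ with $S(h_1)\alpha h_2=\varepsilon(h)\alpha$, $h_1\beta S(h_2)=\varepsilon(h)\beta$, $X^1\beta S(X^2)\alpha X^3=1$, $S(x^1)\alpha x^2\beta S(x^3)=1$. A left Yetter-Drinfeld module over $H$ is a left $H$-module $M$ with a linear map $\lambda_M:M\to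 H\otimes M$, $m\mapsto m_{[-1]}\otimes m_{[0]}$, such that $\varepsilon(m_{[-1]})m_{[0]}=m$, $X^1m_{[-1]}\otimes(X^2\cdot m_{[0]})_{[-1]}X^3\otimes(X^2\cdot m_{[0]})_{[0]}=X^1((Y^1\cdot m)_{[-1]})_1Y^2\otimes X^2((Y^1\cdot m)_{[-1]})_2Y^3\otimes X^3\cdot(Y^1\cdot m)_{[0]}$, and $h_1m_{[-1]}\otimes h_2\cdot m_{[0]}=(h_1\cdot m)_{[-1]}h_2\otimes(h_1\cdot m)_{[0]}$. Morphisms are $H$-linear maps compatible with the coactions. The category ${}_H^H\mathcal{YD}$ is braided monoidal: $h\cdot(m\otimes n)=h_1\cdot m\otimes h_2\cdot n$, coaction $m\otimes n\mapsto X^1(x^1Y^1\cdot m)_{[-1]}x^2(Y^2\cdot n)_{[-1]}Y^3\otimes X^2\cdot(x^1Y^1\cdot m)_{[0]}\otimes X^3x^3\cdot(Y^2\cdot n)_{[0]}$, associativity constraint $(m\otimes n)\otimes p\mapsto X^1\cdot m\otimes(X^2\cdot n\otimes X^3\cdot p)$, unit object $k$ (trivial action via $\varepsilon$ and trivial coaction via $1_H$), braiding $m\otimes n\mapsto m_{[-1]}\cdot n\otimes m_{[0]}$. A braided Hopf algebra (over $H$) is a Hopf algebra in this braided monoidal category. For $(\sigma,v)$ as in the claim, $B_{\sigma,v}$ is the vector space with basis $\{1,n\}$ and: $H$-action $h\cdot 1=\varepsilon(h)1$, $h\cdot n=\sigma(h)n$; $H$-coaction $1\mapsto 1\otimes1$,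 $n\mapsto v\otimes n$; multiplication with unit $1$ and $n^2=0$; comultiplication $1\mapsto1\otimes1$, $n\mapsto n\otimes1+1\otimes n$; counit $1\mapsto1$, $n\mapsto0$; antipode $1\mapsto1$, $n\mapsto-n$. The trivial structure on $k[C_2]$: action through $\varepsilon$, coaction $b\mapsto1_H\otimes b$, and the usual Hopf algebra structure of the group algebra. *)

theory Defs
  imports
    Complex_Main
    "HOL-Library.Poly_Mapping"
    "HOL-Library.Numeral_Type"
    "HOL-Library.Product_Plus"
begin

section \<open>Tensor products of vector spaces\<close>

text \<open>
  An element of \<open>V\<^sub>1 \<otimes> \<dots> \<otimes> V\<^sub>n\<close> is an equivalence class of formal sums of pure tensors.  A formal
  sum is a list of tuples (the coefficients are absorbed into the entries), and two formal sums are
  identified by the least congruence that contains the multilinearity relations.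

  A space of formal sums is described by the scalar multiplication of one summand and by the defining
  relations: \<open>vs s\<close> is a vector space with scalar multiplication \<open>s\<close>, and \<open>A \<otimes> B\<close> is the tensor
  product.  Iterated tensor products are nested to the right, so that the pure tensors of
  \<open>A \<otimes> B \<otimes> C\<close> are the triples \<open>(a, b, c)\<close>.
\<close>

type_synonym ('k, 't) formal = "('k \<Rightarrow> 't \<Rightarrow> 't) \<times> ('t list \<times> 't list) set"

definition vs :: "('k \<Rightarrow> 'v \<Rightarrow> 'v) \<Rightarrow> ('k, 'v::ab_group_add) formal" where
  "vs s = (s, {([x + y], [x, y]) | x y. True} \<union> {([0], [])})"

definition tensor :: "('k, 's) formal \<Rightarrow> ('k, 't) formal \<Rightarrow> ('k, 's \<times> 't) formal"  (infixr \<open>\<otimes>\<close> 70)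
  where
  "A \<otimes> B =
     (\<lambda>c (a, b). (fst A c a, b),
      {(map (\<lambda>a. (a, b)) u, map (\<lambda>a. (a, b)) u') | u u' b. (u, u') \<in> snd A} \<union>
      {(map (\<lambda>b. (a, b)) w, map (\<lambda>b. (a, b)) w') | a w w'. (w, w') \<in> snd B} \<union>
      {([(fst A c a, b)], [(a, fst B c b)]) | c a b. True})"

inductive teq :: "('k, 't) formal \<Rightarrow> 't list \<Rightarrow> 't list \<Rightarrow> bool" for A where
  relation: "(u, u') \<in> snd A \<Longrightarrow> teq A u u'"
| commute: "teq A (u @ w) (w @ u)"
| append: "teq A u u' \<Longrightarrow> teq A w w' \<Longrightarrow> teq A (u @ w) (u' @ w')"
| refl: "teq A u u"
| sym: "teq A u u' \<Longrightarrow> teq A u' u"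
| trans: "teq A u u' \<Longrightarrow> teq A u' u'' \<Longrightarrow> teq A u u''"

definition cls :: "('k, 't) formal \<Rightarrow> 't list \<Rightarrow> 't list set" where
  "cls A u = {u'. teq A u u'}"

definition tensors :: "('k, 't) formal \<Rightarrow> 't list set set" where
  "tensors A = {cls A u | u. True}"

text \<open>
  \<open>terms T\<close> is a formal sum that represents the tensor \<open>T\<close>; the comprehension
  \<open>[f a b. (a, b) \<leftarrow> terms T]\<close> renders the Sweedler notation \<open>f(T\<^sub>1, T\<^sub>2)\<close>.  It is only used where the
  result depends multilinearly on the components, hence not on the representative.
\<close>

definition terms :: "'t list set \<Rightarrow> 't list" where
  "terms T = (SOME u. u \<in> T)"

definition linear_into ::
    "('k \<Rightarrow> 'v \<Rightarrow> 'v) \<Rightarrow> ('k, 't) formal \<Rightarrow> ('v::ab_group_add \<Rightarrow> 't list set) \<Rightarrow> bool" where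
  "linear_into s A f \<longleftrightarrow>
     (\<forall>v. f v \<in> tensors A) \<and>
     (\<forall>v w. f (v + w) = cls A (terms (f v) @ terms (f w))) \<and>
     (\<forall>c v. f (s c v) = cls A (map (fst A c) (terms (f v))))"

lemma cls_eq_iff: "cls A u = cls A u' \<longleftrightarrow> teq A u u'"
  unfolding cls_def by (auto intro: teq.refl teq.sym teq.trans)

lemma teq_terms_cls: "teq A u (terms (cls A u))"
proof -
  have "terms (cls A u) \<in> cls A u"
    unfolding terms_def by (rule someI[of _ u]) (simp add: cls_def teq.refl)
  then show ?thesis by (simp add: cls_def)
qed

lemma teq_vs_iff:
  fixes u u' :: "'v::ab_group_add list"
  shows "teq (vs s) u u' \<longleftrightarrow> sum_list u = sum_list u'"
proof
  show "sum_list u = sum_list u'" if "teq (vs s) u u'"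
    using that by induction (auto simp: vs_def add.commute)
  have norm: "teq (vs s) w [sum_list w]" for w :: "'v list"
  proof (induction w)
    case Nil
    have "([0], []) \<in> snd (vs s)" by (simp add: vs_def)
    then show ?case by (auto intro: teq.sym teq.relation)
  next
    case (Cons x w)
    have "teq (vs s) ([x] @ w) ([x] @ [sum_list w])"
      using Cons by (intro teq.append teq.refl)
    moreover have "([x + sum_list w], [x, sum_list w]) \<in> snd (vs s)"
      by (auto simp: vs_def)
    then have "teq (vs s) [x, sum_list w] [x + sum_list w]"
      by (rule teq.sym[OF teq.relation])
    ultimately show ?case
      using teq.trans[of "vs s" "x # w" "[x, sum_list w]" "[x + sum_list w]"] by simp
  qed
  show "teq (vs s) u u'" if "sum_list u = sum_list u'"
    using norm[of u] norm[of u'] that by (metis teq.sym teq.trans)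
qed

text \<open>The universal property: balanced biadditive maps factor through the tensor product.\<close>

lemma teq_tensor_sum:
  fixes f :: "'v::ab_group_add \<Rightarrow> 'w::ab_group_add \<Rightarrow> 'u::ab_group_add"
  assumes "teq (vs s \<otimes> vs s') u u'"
    and "\<And>x x' y. f (x + x') y = f x y + f x' y"
    and "\<And>x y y'. f x (y + y') = f x y + f x y'"
    and "\<And>c x y. f (s c x) y = f x (s' c y)"
  shows "(\<Sum>(x, y)\<leftarrow>u. f x y) = (\<Sum>(x, y)\<leftarrow>u'. f x y)"
proof -
  have f0: "f 0 y = 0" "f x 0 = 0" for x y
    using assms(2)[of 0 0 y] assms(3)[of x 0 0] by simp_all
  show ?thesis
    using assms(1)
  proof induction
    case (relation u u')
    then show ?case
      unfolding vs_def tensor_def fst_conv snd_conv by (auto simp: assms(2-4) f0)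
  qed (simp_all add: add.commute)
qed


section \<open>Quasi-Hopf algebras\<close>

definition k_algebra :: "('k::field \<Rightarrow> 'h::ring_1 \<Rightarrow> 'h) \<Rightarrow> bool" where
  "k_algebra s \<longleftrightarrow> vector_space s \<and>
     (\<forall>c x y. s c (x * y) = s c x * y \<and> s c (x * y) = x * s c y)"

definition character :: "('k::field \<Rightarrow> 'h::ring_1 \<Rightarrow> 'h) \<Rightarrow> ('h \<Rightarrow> 'k) \<Rightarrow> bool" where
  "character s f \<longleftrightarrow> Vector_Spaces.linear s (*) f \<and> f 1 = 1 \<and> (\<forall>x y. f (x * y) = f x * f y)"

record ('k, 'h) quasi_hopf =
  hscale :: "'k \<Rightarrow> 'h \<Rightarrow> 'h"
  Delta :: "'h \<Rightarrow> ('h \<times> 'h) list set"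
  eps :: "'h \<Rightarrow> 'k"
  Phi :: "('h \<times> 'h \<times> 'h) list set"
  PhiInv :: "('h \<times> 'h \<times> 'h) list set"
  antipode :: "'h \<Rightarrow> 'h"
  alpha :: "'h"
  beta :: "'h"

abbreviation H1 :: "('k, 'h::ring_1, 'z) quasi_hopf_scheme \<Rightarrow> ('k, 'h) formal" where
  "H1 H \<equiv> vs (hscale H)"

text \<open>The four-fold product in \<open>pentagon\<close> is
  \<open>(1 \<otimes> \<Phi>) (id \<otimes> \<Delta> \<otimes> id)(\<Phi>) (\<Phi> \<otimes> 1) = (id \<otimes> id \<otimes> \<Delta>)(\<Phi>) (\<Delta> \<otimes> id \<otimes> id)(\<Phi>)\<close>,
  with the copies of \<open>\<Phi>\<close> named \<open>X\<close>, \<open>Y\<close>, \<open>Z\<close> from left to right.\<close>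

locale quasi_hopf_algebra =
  fixes H :: "('k::field, 'h::ring_1) quasi_hopf"
  assumes algebra: "k_algebra (hscale H)"
    and Delta_linear: "linear_into (hscale H) (H1 H \<otimes> H1 H) (Delta H)"
    and Delta_one: "Delta H 1 = cls (H1 H \<otimes> H1 H) [(1, 1)]"
    and Delta_mult: "Delta H (g * h) =
      cls (H1 H \<otimes> H1 H)
        [(g1 * h1, g2 * h2). (g1, g2) \<leftarrow> terms (Delta H g), (h1, h2) \<leftarrow> terms (Delta H h)]"
    and eps: "character (hscale H) (eps H)"
    and Phi: "Phi H \<in> tensors (H1 H \<otimes> H1 H \<otimes> H1 H)"
    and PhiInv: "PhiInv H \<in> tensors (H1 H \<otimes> H1 H \<otimes> H1 H)"
    and Phi_PhiInv:
      "cls (H1 H \<otimes> H1 H \<otimes> H1 H)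
         [(X1 * x1, X2 * x2, X3 * x3).
            (X1, X2, X3) \<leftarrow> terms (Phi H), (x1, x2, x3) \<leftarrow> terms (PhiInv H)] =
       cls (H1 H \<otimes> H1 H \<otimes> H1 H) [(1, 1, 1)]"
    and PhiInv_Phi:
      "cls (H1 H \<otimes> H1 H \<otimes> H1 H)
         [(x1 * X1, x2 * X2, x3 * X3).
            (x1, x2, x3) \<leftarrow> terms (PhiInv H), (X1, X2, X3) \<leftarrow> terms (Phi H)] =
       cls (H1 H \<otimes> H1 H \<otimes> H1 H) [(1, 1, 1)]"
    and quasi_coassoc:
      "cls (H1 H \<otimes> H1 H \<otimes> H1 H)
         [(h1, a, b). (h1, h2) \<leftarrow> terms (Delta H h), (a, b) \<leftarrow> terms (Delta H h2)] =
       cls (H1 H \<otimes> H1 H \<otimes> H1 H)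
         [(X1 * a * x1, X2 * b * x2, X3 * h2 * x3).
            (X1, X2, X3) \<leftarrow> terms (Phi H),
            (h1, h2) \<leftarrow> terms (Delta H h), (a, b) \<leftarrow> terms (Delta H h1),
            (x1, x2, x3) \<leftarrow> terms (PhiInv H)]"
    and counit_right: "(\<Sum>(h1, h2)\<leftarrow>terms (Delta H h). hscale H (eps H h2) h1) = h"
    and counit_left: "(\<Sum>(h1, h2)\<leftarrow>terms (Delta H h). hscale H (eps H h1) h2) = h"
    and Phi_counit:
      "cls (H1 H \<otimes> H1 H) [(hscale H (eps H X2) X1, X3). (X1, X2, X3) \<leftarrow> terms (Phi H)] =
       cls (H1 H \<otimes> H1 H) [(1, 1)]"
    and pentagon:
      "cls (H1 H \<otimes> H1 H \<otimes> H1 H \<otimes> H1 H)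
         [(Y1 * Z1, X1 * a * Z2, X2 * b * Z3, X3 * Y3).
            (X1, X2, X3) \<leftarrow> terms (Phi H),
            (Y1, Y2, Y3) \<leftarrow> terms (Phi H), (a, b) \<leftarrow> terms (Delta H Y2),
            (Z1, Z2, Z3) \<leftarrow> terms (Phi H)] =
       cls (H1 H \<otimes> H1 H \<otimes> H1 H \<otimes> H1 H)
         [(X1 * c, X2 * d, a * Y2, b * Y3).
            (X1, X2, X3) \<leftarrow> terms (Phi H), (a, b) \<leftarrow> terms (Delta H X3),
            (Y1, Y2, Y3) \<leftarrow> terms (Phi H), (c, d) \<leftarrow> terms (Delta H Y1)]"
    and antipode_linear: "Vector_Spaces.linear (hscale H) (hscale H) (antipode H)"
    and antipode_one: "antipode H 1 = 1"
    and antipode_mult: "antipode H (g * h) = antipode H h * antipode H g"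
    and antipode_alpha:
      "(\<Sum>(h1, h2)\<leftarrow>terms (Delta H h). antipode H h1 * alpha H * h2) = hscale H (eps H h) (alpha H)"
    and antipode_beta:
      "(\<Sum>(h1, h2)\<leftarrow>terms (Delta H h). h1 * beta H * antipode H h2) = hscale H (eps H h) (beta H)"
    and antipode_Phi:
      "(\<Sum>(X1, X2, X3)\<leftarrow>terms (Phi H). X1 * beta H * antipode H X2 * alpha H * X3) = 1"
    and antipode_PhiInv:
      "(\<Sum>(x1, x2, x3)\<leftarrow>terms (PhiInv H). antipode H x1 * alpha H * x2 * beta H * antipode H x3) = 1"


section \<open>The braided category of left Yetter-Drinfeld modules\<close>

record ('k, 'h, 'm) yd =
  vscale :: "'k \<Rightarrow> 'm \<Rightarrow> 'm"
  act :: "'h \<Rightarrow> 'm \<Rightarrow> 'm"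
  coact :: "'m \<Rightarrow> ('h \<times> 'm) list set"

abbreviation V1 :: "('k, 'h, 'm::ab_group_add, 'z) yd_scheme \<Rightarrow> ('k, 'm) formal" where
  "V1 M \<equiv> vs (vscale M)"

locale left_module =
  fixes H :: "('k::field, 'h::ring_1) quasi_hopf" and M :: "('k, 'h, 'm::ab_group_add, 'z) yd_scheme"
  assumes vector_space: "vector_space (vscale M)"
    and act_linear: "Vector_Spaces.linear (vscale M) (vscale M) (act M h)"
    and act_add: "act M (g + h) m = act M g m + act M h m"
    and act_scale: "act M (hscale H c h) m = vscale M c (act M h m)"
    and act_one: "act M 1 m = m"
    and act_mult: "act M (g * h) m = act M g (act M h m)"

locale yetter_drinfeld = left_module H M
  for H :: "('k::field, 'h::ring_1) quasi_hopf" and M :: "('k, 'h, 'm::ab_group_add, 'z) yd_scheme" +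
  assumes coact_linear: "linear_into (vscale M) (H1 H \<otimes> V1 M) (coact M)"
    and coact_counit: "(\<Sum>(g, m0)\<leftarrow>terms (coact M m). vscale M (eps H g) m0) = m"
    and coact_quasi_coassoc:
      "cls (H1 H \<otimes> H1 H \<otimes> V1 M)
         [(X1 * g, l * X3, n).
            (X1, X2, X3) \<leftarrow> terms (Phi H), (g, m0) \<leftarrow> terms (coact M m),
            (l, n) \<leftarrow> terms (coact M (act M X2 m0))] =
       cls (H1 H \<otimes> H1 H \<otimes> V1 M)
         [(X1 * g1 * Y2, X2 * g2 * Y3, act M X3 n).
            (X1, X2, X3) \<leftarrow> terms (Phi H), (Y1, Y2, Y3) \<leftarrow> terms (Phi H),
            (g, n) \<leftarrow> terms (coact M (act M Y1 m)), (g1, g2) \<leftarrow> terms (Delta H g)]"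
    and act_coact:
      "cls (H1 H \<otimes> V1 M)
         [(h1 * g, act M h2 m0). (h1, h2) \<leftarrow> terms (Delta H h), (g, m0) \<leftarrow> terms (coact M m)] =
       cls (H1 H \<otimes> V1 M)
         [(g * h2, m0). (h1, h2) \<leftarrow> terms (Delta H h), (g, m0) \<leftarrow> terms (coact M (act M h1 m))]"

definition yd_morphism ::
    "('k::field, 'h::ring_1) quasi_hopf \<Rightarrow> ('k, 'h, 'm::ab_group_add, 'y) yd_scheme \<Rightarrow>
     ('k, 'h, 'n::ab_group_add, 'z) yd_scheme \<Rightarrow> ('m \<Rightarrow> 'n) \<Rightarrow> bool" where
  "yd_morphism H M N f \<longleftrightarrow>
     Vector_Spaces.linear (vscale M) (vscale N) f \<and>
     (\<forall>h m. f (act M h m) = act N h (f m)) \<and>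
     (\<forall>m. coact N (f m) = cls (H1 H \<otimes> V1 N) [(g, f m0). (g, m0) \<leftarrow> terms (coact M m)])"

text \<open>
  The action and the coaction of \<open>M \<otimes> N\<close>, the associativity constraint \<open>(M \<otimes> N) \<otimes> P \<rightarrow> M \<otimes> (N \<otimes> P)\<close>
  and the braiding \<open>M \<otimes> N \<rightarrow> N \<otimes> M\<close>, evaluated at pure tensors.
\<close>

definition act2 ::
    "('k, 'h::ring_1) quasi_hopf \<Rightarrow> ('k, 'h, 'm, 'y) yd_scheme \<Rightarrow> ('k, 'h, 'n, 'z) yd_scheme \<Rightarrow>
     'h \<Rightarrow> 'm \<times> 'n \<Rightarrow> ('m \<times> 'n) list" where
  "act2 H M N h = (\<lambda>(m, n). [(act M h1 m, act N h2 n). (h1, h2) \<leftarrow> terms (Delta H h)])"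

definition coact2 ::
    "('k, 'h::ring_1) quasi_hopf \<Rightarrow> ('k, 'h, 'm, 'y) yd_scheme \<Rightarrow> ('k, 'h, 'n, 'z) yd_scheme \<Rightarrow>
     'm \<times> 'n \<Rightarrow> ('h \<times> 'm \<times> 'n) list" where
  "coact2 H M N = (\<lambda>(m, n).
     [(X1 * g * x2 * l * Y3, act M X2 m0, act N (X3 * x3) n0).
        (X1, X2, X3) \<leftarrow> terms (Phi H), (x1, x2, x3) \<leftarrow> terms (PhiInv H),
        (Y1, Y2, Y3) \<leftarrow> terms (Phi H),
        (g, m0) \<leftarrow> terms (coact M (act M (x1 * Y1) m)),
        (l, n0) \<leftarrow> terms (coact N (act N Y2 n))])"

definition assoc ::
    "('k, 'h) quasi_hopf \<Rightarrow> ('k, 'h, 'm, 'x) yd_scheme \<Rightarrow> ('k, 'h, 'n, 'y) yd_scheme \<Rightarrow>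
     ('k, 'h, 'p, 'z) yd_scheme \<Rightarrow> ('m \<times> 'n) \<times> 'p \<Rightarrow> ('m \<times> 'n \<times> 'p) list" where
  "assoc H M N P = (\<lambda>((m, n), p).
     [(act M X1 m, act N X2 n, act P X3 p). (X1, X2, X3) \<leftarrow> terms (Phi H)])"

definition braiding ::
    "('k, 'h, 'm, 'y) yd_scheme \<Rightarrow> ('k, 'h, 'n, 'z) yd_scheme \<Rightarrow> 'm \<times> 'n \<Rightarrow> ('n \<times> 'm) list" where
  "braiding M N = (\<lambda>(m, n). [(act N g n, m0). (g, m0) \<leftarrow> terms (coact M m)])"


section \<open>Hopf algebras in the Yetter-Drinfeld category\<close>

record ('k, 'h, 'b) braided_hopf = "('k, 'h, 'b) yd" +
  mul :: "'b \<Rightarrow> 'b \<Rightarrow> 'b"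
  one :: "'b"
  comul :: "'b \<Rightarrow> ('b \<times> 'b) list set"
  counit :: "'b \<Rightarrow> 'k"
  antip :: "'b \<Rightarrow> 'b"

text \<open>
  The product \<open>(a \<otimes> b)(c \<otimes> d)\<close> in the braided tensor product algebra \<open>B \<otimes> B\<close>, that is, the composite
  \<open>(B \<otimes> B) \<otimes> (B \<otimes> B) \<rightarrow> B \<otimes> (B \<otimes> (B \<otimes> B)) \<rightarrow> B \<otimes> ((B \<otimes> B) \<otimes> B) \<rightarrow> B \<otimes> ((B \<otimes> B) \<otimes> B) \<rightarrow>
  B \<otimes> (B \<otimes> (B \<otimes> B)) \<rightarrow> (B \<otimes> B) \<otimes> (B \<otimes> B) \<rightarrow> B \<otimes> B\<close>
  of an associativity constraint (\<open>X\<close>), an inverse one (\<open>x\<close>), the braiding of the middle factors, an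
  associativity constraint (\<open>Y\<close>), an inverse one (\<open>y\<close>) and \<open>mul \<otimes> mul\<close>.  In the first and in the last
  constraint the third object is \<open>B \<otimes> B\<close>, on which \<open>X3\<close> and \<open>y3\<close> act through \<open>Delta\<close>.
\<close>

definition mul2 ::
    "('k, 'h::ring_1) quasi_hopf \<Rightarrow> ('k, 'h, 'b) braided_hopf \<Rightarrow> 'b \<times> 'b \<Rightarrow> 'b \<times> 'b \<Rightarrow> ('b \<times> 'b) list" where
  "mul2 H B = (\<lambda>(a, b) (c, d).
     [(mul B (act B y1 (act B X1 a)) (act B y2 c'), mul B b'' d'').
        (X1, X2, X3) \<leftarrow> terms (Phi H),
        (c1, d1) \<leftarrow> act2 H B B X3 (c, d),
        (x1, x2, x3) \<leftarrow> terms (PhiInv H),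
        (c2, b2) \<leftarrow> braiding B B (act B x1 (act B X2 b), act B x2 c1),
        (c', b', d') \<leftarrow> assoc H B B B ((c2, b2), act B x3 d1),
        (y1, y2, y3) \<leftarrow> terms (PhiInv H),
        (b'', d'') \<leftarrow> act2 H B B y3 (b', d')])"

locale braided_hopf_algebra = yetter_drinfeld H B
  for H :: "('k::field, 'h::ring_1) quasi_hopf" and B :: "('k, 'h, 'b::ab_group_add) braided_hopf" +
  assumes
    \<comment> \<open>the structure maps are morphisms of Yetter-Drinfeld modules\<close>
        mul_linear_left: "Vector_Spaces.linear (vscale B) (vscale B) (\<lambda>a. mul B a b)"
    and mul_linear_right: "Vector_Spaces.linear (vscale B) (vscale B) (mul B a)"
    and mul_act: "act B h (mul B a b) = (\<Sum>(a', b')\<leftarrow>act2 H B B h (a, b). mul B a' b')"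
    and mul_coact: "coact B (mul B a b) =
      cls (H1 H \<otimes> V1 B) [(g, mul B a' b'). (g, a', b') \<leftarrow> coact2 H B B (a, b)]"
    and one_act: "act B h (one B) = vscale B (eps H h) (one B)"
    and one_coact: "coact B (one B) = cls (H1 H \<otimes> V1 B) [(1, one B)]"
    and comul_linear: "linear_into (vscale B) (V1 B \<otimes> V1 B) (comul B)"
    and comul_act: "comul B (act B h b) =
      cls (V1 B \<otimes> V1 B) [t. (b1, b2) \<leftarrow> terms (comul B b), t \<leftarrow> act2 H B B h (b1, b2)]"
    and comul_coact:
      "cls (H1 H \<otimes> V1 B \<otimes> V1 B)
         [(g, b1, b2). (g, b0) \<leftarrow> terms (coact B b), (b1, b2) \<leftarrow> terms (comul B b0)] =
       cls (H1 H \<otimes> V1 B \<otimes> V1 B)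
         [t. (b1, b2) \<leftarrow> terms (comul B b), t \<leftarrow> coact2 H B B (b1, b2)]"
    and counit_linear: "Vector_Spaces.linear (vscale B) (*) (counit B)"
    and counit_act: "counit B (act B h b) = eps H h * counit B b"
    and counit_coact:
      "(\<Sum>(g, b0)\<leftarrow>terms (coact B b). hscale H (counit B b0) g) = hscale H (counit B b) 1"
    and antip_morphism: "yd_morphism H B B (antip B)"
    \<comment> \<open>algebra\<close>
    and mul_assoc: "mul B (mul B a b) c =
      (\<Sum>(a', b', c')\<leftarrow>assoc H B B B ((a, b), c). mul B a' (mul B b' c'))"
    and one_mul: "mul B (one B) b = b"
    and mul_one: "mul B b (one B) = b"
    \<comment> \<open>coalgebra\<close>
    and comul_coassoc:
      "cls (V1 B \<otimes> V1 B \<otimes> V1 B)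
         [t. (b1, b2) \<leftarrow> terms (comul B b), (a, c) \<leftarrow> terms (comul B b1),
             t \<leftarrow> assoc H B B B ((a, c), b2)] =
       cls (V1 B \<otimes> V1 B \<otimes> V1 B)
         [(b1, a, c). (b1, b2) \<leftarrow> terms (comul B b), (a, c) \<leftarrow> terms (comul B b2)]"
    and counit_left: "(\<Sum>(b1, b2)\<leftarrow>terms (comul B b). vscale B (counit B b1) b2) = b"
    and counit_right: "(\<Sum>(b1, b2)\<leftarrow>terms (comul B b). vscale B (counit B b2) b1) = b"
    \<comment> \<open>bialgebra\<close>
    and counit_one: "counit B (one B) = 1"
    and counit_mul: "counit B (mul B a b) = counit B a * counit B b"
    and comul_one: "comul B (one B) = cls (V1 B \<otimes> V1 B) [(one B, one B)]"
    and comul_mul: "comul B (mul B a b) =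
      cls (V1 B \<otimes> V1 B) [t. s \<leftarrow> terms (comul B a), s' \<leftarrow> terms (comul B b), t \<leftarrow> mul2 H B s s']"
    \<comment> \<open>antipode\<close>
    and antip_left: "(\<Sum>(b1, b2)\<leftarrow>terms (comul B b). mul B (antip B b1) b2) = vscale B (counit B b) (one B)"
    and antip_right: "(\<Sum>(b1, b2)\<leftarrow>terms (comul B b). mul B b1 (antip B b2)) = vscale B (counit B b) (one B)"

definition braided_hopf_iso ::
    "('k::field, 'h::ring_1) quasi_hopf \<Rightarrow> ('k, 'h, 'b::ab_group_add) braided_hopf \<Rightarrow>
     ('k, 'h, 'c::ab_group_add) braided_hopf \<Rightarrow> ('b \<Rightarrow> 'c) \<Rightarrow> bool" where
  "braided_hopf_iso H B C f \<longleftrightarrow>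
     bij f \<and> yd_morphism H B C f \<and>
     (\<forall>a b. f (mul B a b) = mul C (f a) (f b)) \<and>
     f (one B) = one C \<and>
     (\<forall>b. comul C (f b) = cls (V1 C \<otimes> V1 C) [(f b1, f b2). (b1, b2) \<leftarrow> terms (comul B b)]) \<and>
     (\<forall>b. counit C (f b) = counit B b) \<and>
     (\<forall>b. f (antip B b) = antip C (f b))"

text \<open>A bijection \<open>f\<close> as above transports the axioms, so a structure isomorphic to a braided Hopf
  algebra is itself a braided Hopf algebra.\<close>

definition braided_hopf_isomorphic ::
    "('k::field, 'h::ring_1) quasi_hopf \<Rightarrow> ('k, 'h, 'b::ab_group_add) braided_hopf \<Rightarrow>
     ('k, 'h, 'c::ab_group_add) braided_hopf \<Rightarrow> bool" where
  "braided_hopf_isomorphic H B C \<longleftrightarrow> (\<exists>f. braided_hopf_iso H B C f)"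


section \<open>The two-dimensional examples\<close>

text \<open>\<open>(x, y)\<close> stands for \<open>x 1 + y n\<close>.\<close>

definition B_sigma_v ::
    "('k::field, 'h::ring_1) quasi_hopf \<Rightarrow> ('h \<Rightarrow> 'k) \<Rightarrow> 'h \<Rightarrow> ('k, 'h, 'k \<times> 'k) braided_hopf" where
  "B_sigma_v H \<sigma> v =
     (let s = (\<lambda>c (x, y). (c * x, c * y)) in
     \<lparr> vscale = s,
       act = (\<lambda>h (x, y). (eps H h * x, \<sigma> h * y)),
       coact = (\<lambda>(x, y). cls (H1 H \<otimes> vs s) [(1, (x, 0)), (v, (0, y))]),
       mul = (\<lambda>(x, y) (x', y'). (x * x', x * y' + y * x')),
       one = (1, 0),
       comul = (\<lambda>(x, y). cls (vs s \<otimes> vs s) [((x, 0), (1, 0)), ((0, y), (1, 0)), ((1, 0), (0, y))]),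
       counit = (\<lambda>(x, y). x),
       antip = (\<lambda>(x, y). (x, - y)) \<rparr>)"

text \<open>The cyclic group \<open>C\<^sub>2\<close> is the additive group of the type \<open>2\<close> of integers modulo 2, and
  \<open>2 \<Rightarrow>\<^sub>0 'k\<close>, with the convolution product of the library, is its group algebra.\<close>

definition kC2 :: "('k::field, 'h::ring_1) quasi_hopf \<Rightarrow> ('k, 'h, 2 \<Rightarrow>\<^sub>0 'k) braided_hopf" where
  "kC2 H =
     (let s = (\<lambda>c. Poly_Mapping.map ((*) c)) in
     \<lparr> vscale = s,
       act = (\<lambda>h. s (eps H h)),
       coact = (\<lambda>b. cls (H1 H \<otimes> vs s) [(1, b)]),
       mul = (*),
       one = 1,
       comul = (\<lambda>b. cls (vs s \<otimes> vs s)
         [(Poly_Mapping.single g (Poly_Mapping.lookup b g), Poly_Mapping.single g 1). g \<leftarrow> [0, 1]]),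
       counit = (\<lambda>b. \<Sum>g\<in>UNIV. Poly_Mapping.lookup b g),
       antip = (\<lambda>b. \<Sum>g\<in>UNIV. Poly_Mapping.single (- g) (Poly_Mapping.lookup b g)) \<rparr>)"

end

theory Submission
  imports Defs
begin

text \<open>
  The counit of \<open>B\<close> is a surjective algebra map, so its kernel is a line, spanned by some \<open>n\<close>, and
  every structure map of \<open>B\<close> is determined by its value at \<open>n\<close>.  Since the structure maps commute
  with the counit, \<open>H\<close> acts on \<open>n\<close> through a character \<open>\<sigma>\<close>, the coaction is \<open>n \<mapsto> v \<otimes> n\<close>, and
  \<open>n\<^sup>2 = \<mu> n\<close> and \<open>\<Delta>(n) = n \<otimes> 1 + 1 \<otimes> n + \<kappa> n \<otimes> n\<close> for scalars \<open>\<mu>\<close> and \<open>\<kappa>\<close>.  What has to be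
  shown is that the axioms leave only two possibilities for \<open>(\<sigma>, v, \<mu>, \<kappa>)\<close>.

  The Yetter-Drinfeld axioms at \<open>n\<close> are precisely the conditions on \<open>(\<sigma>, v)\<close> other than
  \<open>\<sigma>(v) = -1\<close>: see \<open>eps_v\<close>, \<open>sigma_v_commute\<close> and \<open>Delta_v\<close>.  If \<open>\<mu>\<close> or \<open>\<kappa>\<close> is not zero, then
  \<open>H\<close>-linearity of the product or of the coproduct makes \<open>\<sigma>\<close> idempotent for the convolution product,
  and the antipode of \<open>H\<close> then forces \<open>\<sigma> = \<epsilon>\<close> (\<open>sigma_eq_eps\<close>).

  The decisive equation is the coefficient of \<open>n \<otimes> n\<close> in \<open>\<Delta>(n\<^sup>2) = \<Delta>(n)\<Delta>(n)\<close>
  (\<open>bialgebra_equation\<close>).  All vectors in sight are weight vectors, so the reassociators of the braided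
  product act by scalars.
    \<^item> If \<open>\<mu> = 0\<close>, these scalars cancel and the equation becomes \<open>0 = 1 + \<sigma>(v)\<close>.  Then \<open>\<kappa> = 0\<close>, as
      otherwise \<open>\<sigma> = \<epsilon>\<close> and \<open>-1 = \<epsilon>(v) = 1\<close>.  This is \<open>B_sigma_v\<close>.
    \<^item> If \<open>\<mu> \<noteq> 0\<close>, then \<open>\<sigma> = \<epsilon>\<close>, all the scalars are \<open>1\<close>, and \<open>x = \<kappa>\<mu>\<close> satisfies
      \<open>(x + 1)(x + 2) = 0\<close>.  The antipode of \<open>B\<close> excludes \<open>x = -1\<close>; hence \<open>x = -2\<close>, and \<open>1 + \<kappa> n\<close> is a
      group-like element of square \<open>1\<close>.  Moreover \<open>v\<close> is central, invertible and idempotent, so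
      \<open>v = 1\<close> (\<open>v_eq_one\<close>) and the Yetter-Drinfeld structure is trivial.  This is \<open>k[C\<^sub>2]\<close>.

  Identities between tensors are used by evaluating multilinear maps at them.  Conversely, an identity
  in \<open>V \<otimes> W\<close> is proved by applying all \<open>f \<otimes> id\<close> with a linear functional \<open>f\<close> on \<open>V\<close>
  (\<open>teq_vs_tensorI\<close>).
\<close>

section \<open>Evaluating tensors\<close>

text \<open>
  The maps on pure tensors whose sum over a formal sum does not depend on the representative.  They take
  values in an abelian group, as the scalars only enter through the balancing relations.
\<close>

definition multilinear :: "('k, 't) formal \<Rightarrow> ('t \<Rightarrow> 'u::ab_group_add) \<Rightarrow> bool" where
  "multilinear A f \<longleftrightarrow> (\<forall>(w, w') \<in> snd A. sum_list (map f w) = sum_list (map f w'))"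

lemma multilinear_vs:
  fixes f :: "'v::ab_group_add \<Rightarrow> 'u::ab_group_add"
  assumes "\<And>x y. f (x + y) = f x + f y"
  shows "multilinear (vs s) f"
proof -
  have "f 0 = 0" using assms[of 0 0] by simp
  then show ?thesis by (auto simp: multilinear_def vs_def assms)
qed

lemma multilinear_tensor:
  assumes "\<And>b. multilinear A (\<lambda>a. f (a, b))" and "\<And>a. multilinear B (\<lambda>b. f (a, b))"
    and "\<And>c a b. f (fst A c a, b) = f (a, fst B c b)"
  shows "multilinear (A \<otimes> B) f"
proof -
  have "sum_list (map (\<lambda>a. f (a, b)) u) = sum_list (map (\<lambda>a. f (a, b)) u')"
    if "(u, u') \<in> snd A" for u u' b
    using assms(1)[of b] that by (auto simp: multilinear_def)
  moreover have "sum_list (map (\<lambda>b. f (a, b)) w) = sum_list (map (\<lambda>b. f (a, b)) w')"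
    if "(w, w') \<in> snd B" for w w' a
    using assms(2)[of a] that by (auto simp: multilinear_def)
  ultimately show ?thesis
    using assms(3) by (auto simp: multilinear_def tensor_def comp_def)
qed

lemma multilinear_vs_tensorD:
  assumes "multilinear (vs s \<otimes> vs s') f"
  shows "f (x + x', y) = f (x, y) + f (x', y)" "f (x, y + y') = f (x, y) + f (x, y')"
    "f (s c x, y) = f (x, s' c y)"
proof -
  have rel: "sum_list (map f w) = sum_list (map f w')" if "(w, w') \<in> snd (vs s \<otimes> vs s')" for w w'
    using assms that by (auto simp: multilinear_def)
  have "([x + x'], [x, x']) \<in> snd (vs s)" "([y + y'], [y, y']) \<in> snd (vs s')"
    by (auto simp: vs_def)
  then have "(map (\<lambda>a. (a, y)) [x + x'], map (\<lambda>a. (a, y)) [x, x']) \<in> snd (vs s \<otimes> vs s')"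
    "(map (\<lambda>b. (x, b)) [y + y'], map (\<lambda>b. (x, b)) [y, y']) \<in> snd (vs s \<otimes> vs s')"
    unfolding tensor_def snd_conv by blast+
  from this[THEN rel] show "f (x + x', y) = f (x, y) + f (x', y)" "f (x, y + y') = f (x, y) + f (x, y')"
    by simp_all
  show "f (s c x, y) = f (x, s' c y)"
    using rel[of "[(s c x, y)]" "[(x, s' c y)]"] by (auto simp: tensor_def vs_def)
qed

lemma fst_vs: "fst (vs s) = s" by (simp add: vs_def)
lemma fst_tensor: "fst (A \<otimes> B) c t = (fst A c (fst t), snd t)"
  by (simp add: tensor_def case_prod_unfold)

lemma teq_sum_eq:
  assumes "teq A u u'" and "multilinear A f"
  shows "sum_list (map f u) = sum_list (map f u')"
  using assms(1)
proof induction
  case (relation u u')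
  then show ?case using assms(2) by (auto simp: multilinear_def)
qed (simp_all add: add.commute)

lemma cls_sum_eq:
  assumes "cls A u = cls A u'" and "multilinear A f"
  shows "sum_list (map f u) = sum_list (map f u')"
  using teq_sum_eq[OF _ assms(2)] assms(1) by (simp add: cls_eq_iff)

lemma sum_terms_cls:
  assumes "multilinear A f"
  shows "sum_list (map f (terms (cls A u))) = sum_list (map f u)"
  using assms teq_sum_eq[OF teq_terms_cls] by metis

text \<open>
  This is how Sweedler notation is evaluated: as soon as a formal sum is known for \<open>T\<close>, it can replace
  the arbitrary representative \<open>terms T\<close> in every multilinear expression.
\<close>

lemma sum_terms:
  assumes "T = cls A u" and "multilinear A f"
  shows "sum_list (map f (terms T)) = sum_list (map f u)"
  using assms sum_terms_cls by metis

lemma cls_terms: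
  assumes "T \<in> tensors A"
  shows "cls A (terms T) = T"
proof -
  from assms obtain u where T: "T = cls A u" by (auto simp: tensors_def)
  show ?thesis unfolding T using teq_terms_cls[of A u] by (metis cls_eq_iff)
qed

lemma linear_into_add:
  assumes "linear_into s A f" and "multilinear A g"
  shows "sum_list (map g (terms (f (x + y)))) = sum_list (map g (terms (f x))) + sum_list (map g (terms (f y)))"
proof -
  have "f (x + y) = cls A (terms (f x) @ terms (f y))" using assms(1) by (simp add: linear_into_def)
  from sum_terms[OF this assms(2)] show ?thesis by simp
qed

lemma linear_into_scale:
  assumes "linear_into s A f" and "multilinear A g"
  shows "sum_list (map g (terms (f (s c x)))) = sum_list (map (\<lambda>t. g (fst A c t)) (terms (f x)))"
proof -
  have "f (s c x) = cls A (map (fst A c) (terms (f x)))" using assms(1) by (simp add: linear_into_def)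
  from sum_terms[OF this assms(2)] show ?thesis by (simp add: comp_def)
qed

lemma linear_into_cls:
  assumes "linear_into s A f"
  shows "cls A (terms (f x)) = f x"
  by (rule cls_terms) (use assms in \<open>simp add: linear_into_def\<close>)

lemma sum_list_concat_map:
  "sum_list (map f (concat (map g xs))) = (\<Sum>x\<leftarrow>xs. sum_list (map f (g x)))"
  by (induction xs) auto

lemma sum_list_swap:
  fixes f :: "'a \<Rightarrow> 'b \<Rightarrow> 'c::comm_monoid_add"
  shows "(\<Sum>x\<leftarrow>xs. \<Sum>y\<leftarrow>ys. f x y) = (\<Sum>y\<leftarrow>ys. \<Sum>x\<leftarrow>xs. f x y)"
  by (induction xs) (simp_all add: sum_list_addf)

lemma sum_list_additive:
  fixes f :: "'a::ab_group_add \<Rightarrow> 'b::ab_group_add"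
  assumes "\<And>x y. f (x + y) = f x + f y"
  shows "f (sum_list xs) = (\<Sum>x\<leftarrow>xs. f x)"
proof -
  have "f 0 = 0" using assms[of 0 0] by simp
  then show ?thesis by (induction xs) (simp_all add: assms)
qed

lemma teq_map_append:
  assumes "\<And>e. e \<in> set es \<Longrightarrow> teq A [p e, q e] [r e]"
  shows "teq A (map p es @ map q es) (map r es)"
  using assms
proof (induction es)
  case (Cons e es)
  have *: "teq A (map p es @ [q e]) (q e # map p es)"
    using teq.commute[of A "map p es" "[q e]"] by simp
  have "teq A (p e # ((map p es @ [q e]) @ map q es)) (p e # ((q e # map p es) @ map q es))"
    using teq.append[OF teq.refl[of A "[p e]"] teq.append[OF * teq.refl]] by simp
  also have "p e # ((q e # map p es) @ map q es) = [p e, q e] @ (map p es @ map q es)" by simp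
  finally have "teq A (map p (e # es) @ map q (e # es)) ([p e, q e] @ (map p es @ map q es))" by simp
  moreover have "teq A ([p e, q e] @ (map p es @ map q es)) ([r e] @ map r es)"
    using Cons by (intro teq.append) auto
  ultimately show ?case using teq.trans by fastforce
qed (simp add: teq.refl)

lemma
  shows teq_add_left: "teq (vs s \<otimes> B) [(x, b), (y, b)] [(x + y, b)]"
    and teq_zero_left: "teq (vs s \<otimes> B) [(0, b)] []"
    and teq_add_right: "teq (A \<otimes> vs s') [(a, x'), (a, y')] [(a, x' + y')]"
    and teq_zero_right: "teq (A \<otimes> vs s') [(a, 0)] []"
    and teq_balanced: "teq (A \<otimes> B) [(fst A c a, b)] [(a, fst B c b)]"
proof -
  have map: "teq (A \<otimes> B) (map (\<lambda>a. (a, b)) w) (map (\<lambda>a. (a, b)) w')"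
    if "(w, w') \<in> snd A" for A :: "('k, 'p) formal" and B :: "('k, 'q) formal" and w w' b
    by (rule teq.relation) (unfold tensor_def snd_conv, use that in blast)
  have map': "teq (A \<otimes> B) (map (\<lambda>b. (a, b)) w) (map (\<lambda>b. (a, b)) w')"
    if "(w, w') \<in> snd B" for A :: "('k, 'p) formal" and B :: "('k, 'q) formal" and w w' a
    by (rule teq.relation) (unfold tensor_def snd_conv, use that in blast)
  show "teq (vs s \<otimes> B) [(x, b), (y, b)] [(x + y, b)]"
    using map[of "[x + y]" "[x, y]" "vs s" B b] by (auto simp: vs_def intro: teq.sym)
  show "teq (vs s \<otimes> B) [(0, b)] []"
    using map[of "[0]" "[]" "vs s" B b] by (auto simp: vs_def)
  show "teq (A \<otimes> vs s') [(a, x'), (a, y')] [(a, x' + y')]"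
    using map'[of "[x' + y']" "[x', y']" "vs s'" A a] by (auto simp: vs_def intro: teq.sym)
  show "teq (A \<otimes> vs s') [(a, 0)] []"
    using map'[of "[0]" "[]" "vs s'" A a] by (auto simp: vs_def)
  show "teq (A \<otimes> B) [(fst A c a, b)] [(a, fst B c b)]"
    by (intro teq.relation) (auto simp: tensor_def)
qed

lemma teq_sum_left:
  "teq (vs s \<otimes> B) [(sum_list (map p es), b)] (map (\<lambda>e. (p e, b)) es)"
proof (induction es)
  case (Cons e es)
  have "teq (vs s \<otimes> B) [(p e + sum_list (map p es), b)] ([(p e, b)] @ [(sum_list (map p es), b)])"
    using teq_add_left teq.sym by fastforce
  moreover have "teq (vs s \<otimes> B) ([(p e, b)] @ [(sum_list (map p es), b)]) ([(p e, b)] @ map (\<lambda>e. (p e, b)) es)"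
    by (intro teq.append teq.refl Cons)
  ultimately show ?case using teq.trans by fastforce
qed (simp add: teq_zero_left)

text \<open>
  Functionals on the left factor separate tensors: both formal sums can be rewritten as
  \<open>\<Sum> e \<otimes> w\<^sub>e\<close> over the finitely many elements \<open>e\<close> of a basis of \<open>V\<close> that occur in them, and then \<open>w\<^sub>e\<close>
  is the image under \<open>e\<^sup>* \<otimes> id\<close>, where \<open>e\<^sup>*\<close> is the coordinate functional of \<open>e\<close>.
\<close>

lemma teq_vs_tensorI:
  fixes s :: "'k::field \<Rightarrow> 'v::ab_group_add \<Rightarrow> 'v" and s' :: "'k \<Rightarrow> 'w::ab_group_add \<Rightarrow> 'w"
  assumes "vector_space s" and "vector_space s'"
    and eq: "\<And>f. Vector_Spaces.linear s (*) f \<Longrightarrow>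
      (\<Sum>(x, y)\<leftarrow>u. s' (f x) y) = (\<Sum>(x, y)\<leftarrow>u'. s' (f x) y)"
  shows "teq (vs s \<otimes> vs s') u u'"
proof -
  interpret V: vector_space s by fact
  interpret W: vector_space s' by fact
  define E where "E = V.extend_basis {}"
  have E: "V.independent E" "V.span E = UNIV"
    using V.independent_extend_basis[of "{}"] V.span_extend_basis[of "{}"]
    by (auto simp: E_def V.independent_empty)
  define r where "r = V.representation E"
  have r_linear: "Vector_Spaces.linear s (*) (\<lambda>x. r x e)" for e
  proof (unfold_locales)
    show "r (x + y) e = r x e + r y e" for x y
      unfolding r_def by (simp add: V.representation_add E)
    show "r (s c x) e = c * r x e" for c x
      unfolding r_def by (simp add: V.representation_scale E)
  qed (simp_all add: algebra_simps)
  define I where "I = (\<Union>(x, y)\<in>set (u @ u'). {e. r x e \<noteq> 0})"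
  have "finite I"
    unfolding I_def r_def by (auto simp: V.finite_representation)
  then obtain es where es: "set es = I" "distinct es" using finite_distinct_list by blast
  let ?q = "\<lambda>w e. (\<Sum>(x, y)\<leftarrow>w. s' (r x e) y)"
  have expand: "teq (vs s \<otimes> vs s') w (map (\<lambda>e. (e, ?q w e)) es)" if "set w \<subseteq> set (u @ u')" for w
    using that
  proof (induction w)
    case Nil
    have "teq (vs s \<otimes> vs s') [] (map (\<lambda>e. (e, 0)) es')" for es'
    proof (induction es')
      case (Cons e es')
      then show ?case
        using teq.append[OF teq.sym[OF teq_zero_right] Cons] by simp
    qed (simp add: teq.refl)
    then show ?case by simp
  next
    case (Cons p w)
    obtain x y where p: "p = (x, y)" by force
    have sub: "{e. r x e \<noteq> 0} \<subseteq> I" using Cons.prems by (auto simp: I_def p)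
    have "x = (\<Sum>e\<in>{e. r x e \<noteq> 0}. s (r x e) e)"
      using V.sum_nonzero_representation_eq[OF E(1), of x] E(2) by (simp add: r_def)
    also have "\<dots> = (\<Sum>e\<in>I. s (r x e) e)"
      using sub \<open>finite I\<close> by (intro sum.mono_neutral_left) auto
    also have "\<dots> = (\<Sum>e\<leftarrow>es. s (r x e) e)"
      using es by (simp add: sum_list_distinct_conv_sum_set)
    finally have x: "x = (\<Sum>e\<leftarrow>es. s (r x e) e)" .
    have move: "teq (vs s \<otimes> vs s') (map (\<lambda>e. (s (r x e) e, y)) es') (map (\<lambda>e. (e, s' (r x e) y)) es')" for es'
    proof (induction es')
      case (Cons e es')
      have "teq (vs s \<otimes> vs s') [(s (r x e) e, y)] [(e, s' (r x e) y)]"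
        using teq_balanced[of "vs s" "vs s'" "r x e" e y] by (simp add: vs_def)
      from teq.append[OF this Cons] show ?case by simp
    qed (simp add: teq.refl)
    have "teq (vs s \<otimes> vs s') [(x, y)] (map (\<lambda>e. (s (r x e) e, y)) es)"
      using teq_sum_left[of s "vs s'" "\<lambda>e. s (r x e) e" es y] x by simp
    then have "teq (vs s \<otimes> vs s') [(x, y)] (map (\<lambda>e. (e, s' (r x e) y)) es)"
      using move teq.trans by blast
    then have "teq (vs s \<otimes> vs s') ([p] @ w)
        (map (\<lambda>e. (e, s' (r x e) y)) es @ map (\<lambda>e. (e, ?q w e)) es)"
      unfolding p using Cons by (intro teq.append) auto
    moreover have "teq (vs s \<otimes> vs s') (map (\<lambda>e. (e, s' (r x e) y)) es @ map (\<lambda>e. (e, ?q w e)) es)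
        (map (\<lambda>e. (e, s' (r x e) y + ?q w e)) es)"
      by (intro teq_map_append teq_add_right)
    ultimately show ?case using teq.trans by (fastforce simp: p)
  qed
  have "?q u e = ?q u' e" for e using eq[OF r_linear] .
  then show ?thesis
    using expand[of u] expand[of u'] teq.trans teq.sym by simp blast
qed

section \<open>Characters of a quasi-Hopf algebra\<close>

lemma characterD:
  assumes "character s f"
  shows "f (x + y) = f x + f y" "f (s c x) = c * f x" "f 1 = 1" "f (x * y) = f x * f y"
  using assms Vector_Spaces.linear.axioms[of s "(*)" f]
  by (auto simp: character_def module_hom_iff Vector_Spaces.linear_iff_module_hom)

lemma linear_functionalD:
  assumes "Vector_Spaces.linear s s' f"
  shows "f (x + y) = f x + f y" "f (s c x) = s' c (f x)"
  using assms
  by (auto simp: module_hom_iff Vector_Spaces.linear_iff_module_hom)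

lemma linear_zero:
  assumes "Vector_Spaces.linear s s' f"
  shows "f 0 = 0"
  using assms by (simp add: Vector_Spaces.linear_iff_module_hom module_hom.zero)

text \<open>
  The value of \<open>f \<otimes> g \<otimes> l\<close> at a tensor; for characters and \<open>T = \<Phi>\<close> it is the scalar by which an
  associativity constraint acts on a pure tensor of weight vectors.
\<close>

definition eval3 :: "('h \<times> 'h \<times> 'h) list set \<Rightarrow> ('h \<Rightarrow> 'k) \<Rightarrow> ('h \<Rightarrow> 'k) \<Rightarrow> ('h \<Rightarrow> 'k::field) \<Rightarrow> 'k" where
  "eval3 T f g l = (\<Sum>(x1, x2, x3)\<leftarrow>terms T. f x1 * g x2 * l x3)"

context quasi_hopf_algebra
begin

lemma hscale_simps:
  "hscale H c (x + y) = hscale H c x + hscale H c y"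
  "hscale H (a + b) x = hscale H a x + hscale H b x"
  "hscale H a (hscale H b x) = hscale H (a * b) x"
  "hscale H 1 x = x"
  "hscale H 0 x = 0"
  "hscale H c 0 = 0"
  "hscale H c x * y = hscale H c (x * y)"
  "x * hscale H c y = hscale H c (x * y)"
proof -
  interpret vector_space "hscale H" using algebra by (simp add: k_algebra_def)
  show "hscale H c (x + y) = hscale H c x + hscale H c y"
  "hscale H (a + b) x = hscale H a x + hscale H b x"
  "hscale H a (hscale H b x) = hscale H (a * b) x"
  "hscale H 1 x = x"
  "hscale H 0 x = 0"
  "hscale H c 0 = 0" by (simp_all add: scale_right_distrib scale_left_distrib)
  show "hscale H c x * y = hscale H c (x * y)"
  "x * hscale H c y = hscale H c (x * y)" using algebra by (metis k_algebra_def)+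
qed

lemmas eps_simps = characterD[OF eps]
lemmas antipode_simps = linear_functionalD[OF antipode_linear] antipode_one antipode_mult

lemmas distribs = hscale_simps distrib_left distrib_right sum_list_addf fst_vs fst_tensor case_prod_unfold
  mult_ac

text \<open>
  An axiom that equates two tensors becomes a rewrite rule for sums of an arbitrary multilinear \<open>F\<close>.
\<close>

lemma Phi_PhiInv_sum:
  assumes "multilinear (H1 H \<otimes> H1 H \<otimes> H1 H) (\<lambda>(x, y, z). F x y z)"
  shows "(\<Sum>(X1, X2, X3)\<leftarrow>terms (Phi H). \<Sum>(x1, x2, x3)\<leftarrow>terms (PhiInv H).
    F (X1 * x1) (X2 * x2) (X3 * x3)) = F 1 1 1"
  using cls_sum_eq[OF Phi_PhiInv assms] by (simp add: sum_list_concat_map case_prod_unfold comp_def)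

lemma PhiInv_Phi_sum:
  assumes "multilinear (H1 H \<otimes> H1 H \<otimes> H1 H) (\<lambda>(x, y, z). F x y z)"
  shows "(\<Sum>(x1, x2, x3)\<leftarrow>terms (PhiInv H). \<Sum>(X1, X2, X3)\<leftarrow>terms (Phi H).
    F (x1 * X1) (x2 * X2) (x3 * X3)) = F 1 1 1"
  using cls_sum_eq[OF PhiInv_Phi assms] by (simp add: sum_list_concat_map case_prod_unfold comp_def)

lemma quasi_coassoc_sum:
  assumes "multilinear (H1 H \<otimes> H1 H \<otimes> H1 H) (\<lambda>(x, y, z). F x y z)"
  shows "(\<Sum>(h1, h2)\<leftarrow>terms (Delta H h). \<Sum>(a, b)\<leftarrow>terms (Delta H h2). F h1 a b) =
    (\<Sum>(X1, X2, X3)\<leftarrow>terms (Phi H). \<Sum>(h1, h2)\<leftarrow>terms (Delta H h).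
      \<Sum>(a, b)\<leftarrow>terms (Delta H h1). \<Sum>(x1, x2, x3)\<leftarrow>terms (PhiInv H).
        F (X1 * a * x1) (X2 * b * x2) (X3 * h2 * x3))"
  using cls_sum_eq[OF quasi_coassoc assms, of h] by (simp add: sum_list_concat_map case_prod_unfold comp_def)

lemma pentagon_sum:
  assumes "multilinear (H1 H \<otimes> H1 H \<otimes> H1 H \<otimes> H1 H) (\<lambda>(x, y, z, w). F x y z w)"
  shows "(\<Sum>(X1, X2, X3)\<leftarrow>terms (Phi H). \<Sum>(Y1, Y2, Y3)\<leftarrow>terms (Phi H).
      \<Sum>(a, b)\<leftarrow>terms (Delta H Y2). \<Sum>(Z1, Z2, Z3)\<leftarrow>terms (Phi H).
        F (Y1 * Z1) (X1 * a * Z2) (X2 * b * Z3) (X3 * Y3)) =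
    (\<Sum>(X1, X2, X3)\<leftarrow>terms (Phi H). \<Sum>(a, b)\<leftarrow>terms (Delta H X3).
      \<Sum>(Y1, Y2, Y3)\<leftarrow>terms (Phi H). \<Sum>(c, d)\<leftarrow>terms (Delta H Y1).
        F (X1 * c) (X2 * d) (a * Y2) (b * Y3))"
  using cls_sum_eq[OF pentagon assms] by (simp add: sum_list_concat_map case_prod_unfold comp_def)

lemma counit_left_apply:
  assumes "\<And>x y. f (x + y) = (f x + f y :: 'u::ab_group_add)"
  shows "(\<Sum>(h1, h2)\<leftarrow>terms (Delta H h). f (hscale H (eps H h1) h2)) = f h"
  using sum_list_additive[of f "map (\<lambda>(h1, h2). hscale H (eps H h1) h2) (terms (Delta H h))"] assms
  by (simp add: counit_left[unfolded case_prod_unfold] comp_def case_prod_unfold)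

lemma counit_right_apply:
  assumes "\<And>x y. f (x + y) = (f x + f y :: 'u::ab_group_add)"
  shows "(\<Sum>(h1, h2)\<leftarrow>terms (Delta H h). f (hscale H (eps H h2) h1)) = f h"
  using sum_list_additive[of f "map (\<lambda>(h1, h2). hscale H (eps H h2) h1) (terms (Delta H h))"] assms
  by (simp add: counit_right[unfolded case_prod_unfold] comp_def case_prod_unfold)

lemma counit_left_linear:
  assumes "\<And>x y. f (x + y) = f x + f y" "\<And>c x. f (hscale H c x) = c * f x"
  shows "(\<Sum>(h1, h2)\<leftarrow>terms (Delta H h). eps H h1 * f h2) = f h"
  using counit_left_apply[of f h] assms by simp

lemma counit_right_linear:
  assumes "\<And>x y. f (x + y) = f x + f y" "\<And>c x. f (hscale H c x) = c * f x"
  shows "(\<Sum>(h1, h2)\<leftarrow>terms (Delta H h). f h1 * eps H h2) = f h"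
  using counit_right_apply[of f h] assms by (simp add: mult.commute)

definition conv :: "('h \<Rightarrow> 'k) \<Rightarrow> ('h \<Rightarrow> 'k) \<Rightarrow> 'h \<Rightarrow> 'k" where
  "conv f g h = (\<Sum>(h1, h2)\<leftarrow>terms (Delta H h). f h1 * g h2)"

lemma conv_eps:
  assumes "character (hscale H) f"
  shows "conv (eps H) f = f" "conv f (eps H) = f"
  using counit_left_linear[of f] counit_right_linear[of f]
  by (auto simp: conv_def characterD[OF assms])

lemma multilinear_characters3:
  assumes "character (hscale H) f" "character (hscale H) g" "character (hscale H) l"
  shows "multilinear (H1 H \<otimes> H1 H \<otimes> H1 H) (\<lambda>(x, y, z). f x * g y * l z)"
  by (intro multilinear_tensor multilinear_vs; simp add: distribs characterD[OF assms(1)]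
      characterD[OF assms(2)] characterD[OF assms(3)])

lemma eval3_inverse:
  assumes "character (hscale H) f" "character (hscale H) g" "character (hscale H) l"
  shows "eval3 (Phi H) f g l * eval3 (PhiInv H) f g l = 1"
proof -
  note ch = characterD[OF assms(1)] characterD[OF assms(2)] characterD[OF assms(3)]
  have "(\<Sum>(X1, X2, X3)\<leftarrow>terms (Phi H). \<Sum>(x1, x2, x3)\<leftarrow>terms (PhiInv H).
    f (X1 * x1) * g (X2 * x2) * l (X3 * x3)) = 1"
    using Phi_PhiInv_sum[OF multilinear_characters3[OF assms]] by (simp add: ch)
  \<comment> \<open>Expanding first the left and then the right factor of each product of sums nests the
    sums in the order of the factors.\<close>
  then show ?thesis
    by (simp only: eval3_def case_prod_unfold sum_list_mult_const[symmetric],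
      simp only: sum_list_const_mult[symmetric], simp add: ch mult_ac case_prod_unfold)
qed

lemma eval3_eps: "eval3 (Phi H) (eps H) (eps H) (eps H) = 1" "eval3 (PhiInv H) (eps H) (eps H) (eps H) = 1"
proof -
  have "multilinear (H1 H \<otimes> H1 H) (\<lambda>(x, z). eps H x * eps H z)"
    by (intro multilinear_tensor multilinear_vs; simp add: distribs eps_simps)
  from cls_sum_eq[OF Phi_counit this] show *: "eval3 (Phi H) (eps H) (eps H) (eps H) = 1"
    by (simp add: eval3_def sum_list_concat_map case_prod_unfold comp_def eps_simps mult_ac)
  then show "eval3 (PhiInv H) (eps H) (eps H) (eps H) = 1"
    using eval3_inverse[OF eps eps eps] by simp
qed

text \<open>
  Apply the character to \<open>X\<^sup>1\<beta>S(X\<^sup>2)\<alpha>X\<^sup>3 = 1\<close>: every summand on the left contains its value at \<open>\<alpha>\<close>.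
\<close>

lemma character_alpha_nonzero:
  assumes "character (hscale H) f"
  shows "f (alpha H) \<noteq> 0"
proof
  note ch = characterD[OF assms]
  assume "f (alpha H) = 0"
  then have "(\<Sum>(X1, X2, X3)\<leftarrow>terms (Phi H). f (X1 * beta H * antipode H X2 * alpha H * X3)) = 0"
    by (simp add: ch case_prod_unfold)
  moreover have "f (\<Sum>(X1, X2, X3)\<leftarrow>terms (Phi H). X1 * beta H * antipode H X2 * alpha H * X3) =
     (\<Sum>(X1, X2, X3)\<leftarrow>terms (Phi H). f (X1 * beta H * antipode H X2 * alpha H * X3))"
    by (subst sum_list_additive[of f]) (simp_all add: ch comp_def case_prod_unfold)
  ultimately show False using antipode_Phi ch(3) by simp
qed

text \<open>
  Characters form a monoid under convolution, since they do not see the conjugation by \<open>\<Phi>\<close> in the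
  coassociativity law.  Applying \<open>f\<close> to \<open>S(h\<^sub>1)\<alpha>h\<^sub>2 = \<epsilon>(h)\<alpha>\<close> and cancelling \<open>f(\<alpha>)\<close> shows that \<open>g = f \<circ> S\<close> is
  a left inverse of \<open>f\<close>; a left invertible idempotent is the unit:
  \<open>\<epsilon> = g * f = g * (f * f) = (g * f) * f = f\<close>.
\<close>

lemma idempotent_character_eq_eps:
  assumes "character (hscale H) f"
    and "\<And>h. (\<Sum>(h1, h2)\<leftarrow>terms (Delta H h). f h1 * f h2) = f h"
  shows "f = eps H"
proof
  fix h
  note ch = characterD[OF assms(1)]
  define g where "g x = f (antipode H x)" for x
  have g: "g (x + y) = g x + g y" "g (hscale H c x) = c * g x" "g 1 = 1" "g (x * y) = g x * g y" for x y c
    by (simp_all add: g_def ch antipode_simps mult.commute)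
  have inv: "(\<Sum>(h1, h2)\<leftarrow>terms (Delta H h). g h1 * f h2) = eps H h" for h
  proof -
    have "f (\<Sum>(h1, h2)\<leftarrow>terms (Delta H h). antipode H h1 * alpha H * h2) =
      (\<Sum>(h1, h2)\<leftarrow>terms (Delta H h). g h1 * f h2) * f (alpha H)"
      by (subst sum_list_additive[of f])
        (simp_all add: ch comp_def case_prod_unfold g_def sum_list_const_mult[symmetric] mult_ac)
    then show ?thesis
      using character_alpha_nonzero[OF assms(1)] by (simp add: antipode_alpha ch)
  qed
  have ml: "multilinear (H1 H \<otimes> H1 H \<otimes> H1 H) (\<lambda>(x, y, z). g x * f y * f z)"
    by (intro multilinear_tensor multilinear_vs; simp add: distribs ch g)
  have "eps H h = (\<Sum>(h1, h2)\<leftarrow>terms (Delta H h). \<Sum>(a, b)\<leftarrow>terms (Delta H h2). g h1 * f a * f b)"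
  proof -
    have "eps H h = (\<Sum>(h1, h2)\<leftarrow>terms (Delta H h). g h1 * (\<Sum>(a, b)\<leftarrow>terms (Delta H h2). f a * f b))"
      by (simp only: assms(2) inv)
    then show ?thesis
      by (simp add: case_prod_unfold mult.assoc sum_list_const_mult)
  qed
  also have "\<dots> = (\<Sum>(X1, X2, X3)\<leftarrow>terms (Phi H). \<Sum>(h1, h2)\<leftarrow>terms (Delta H h).
      \<Sum>(a, b)\<leftarrow>terms (Delta H h1). \<Sum>(x1, x2, x3)\<leftarrow>terms (PhiInv H).
        g (X1 * a * x1) * f (X2 * b * x2) * f (X3 * h2 * x3))"
    by (rule quasi_coassoc_sum[OF ml])
  also have "\<dots> = eval3 (Phi H) g f f * ((\<Sum>(h1, h2)\<leftarrow>terms (Delta H h).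
      (\<Sum>(a, b)\<leftarrow>terms (Delta H h1). g a * f b) * f h2) * eval3 (PhiInv H) g f f)"
    by (simp only: eval3_def case_prod_unfold sum_list_mult_const[symmetric],
      simp only: sum_list_const_mult[symmetric], simp add: ch g mult_ac)
  also have "\<dots> = (\<Sum>(h1, h2)\<leftarrow>terms (Delta H h). eps H h1 * f h2) *
     (eval3 (Phi H) g f f * eval3 (PhiInv H) g f f)"
    by (simp only: inv) (simp add: mult_ac)
  also have "eval3 (Phi H) g f f * eval3 (PhiInv H) g f f = 1"
  proof -
    have "(\<Sum>(X1, X2, X3)\<leftarrow>terms (Phi H). \<Sum>(x1, x2, x3)\<leftarrow>terms (PhiInv H).
      g (X1 * x1) * f (X2 * x2) * f (X3 * x3)) = 1"
      using Phi_PhiInv_sum[OF ml] by (simp add: ch g)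
    then show ?thesis
    by (simp only: eval3_def case_prod_unfold sum_list_mult_const[symmetric],
      simp only: sum_list_const_mult[symmetric], simp add: ch g mult_ac case_prod_unfold)
  qed
  finally show "f h = eps H h"
    using counit_left_linear[of f h] by (simp add: ch)
qed

lemma Phi_id_eps_eps: "(\<Sum>(X1, X2, X3)\<leftarrow>terms (Phi H). hscale H (eps H X2 * eps H X3) X1) = 1"
  and Phi_eps_eps_id: "(\<Sum>(X1, X2, X3)\<leftarrow>terms (Phi H). hscale H (eps H X1 * eps H X2) X3) = 1"
proof -
  have "multilinear (H1 H \<otimes> H1 H) (\<lambda>(x, z). hscale H (eps H z) x)"
    "multilinear (H1 H \<otimes> H1 H) (\<lambda>(x, z). hscale H (eps H x) z)"
    by (intro multilinear_tensor multilinear_vs; simp add: distribs eps_simps)+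
  from this[THEN cls_sum_eq[OF Phi_counit]]
  show "(\<Sum>(X1, X2, X3)\<leftarrow>terms (Phi H). hscale H (eps H X2 * eps H X3) X1) = 1"
    "(\<Sum>(X1, X2, X3)\<leftarrow>terms (Phi H). hscale H (eps H X1 * eps H X2) X3) = 1"
    by (simp_all add: sum_list_concat_map case_prod_unfold comp_def eps_simps hscale_simps mult_ac)
qed

text \<open>
  In contrast to \<open>Phi_id_eps_eps\<close> and \<open>Phi_eps_eps_id\<close>, this is not an instance of the counit axiom
  for \<open>\<Phi>\<close>.  Applying \<open>\<epsilon> \<otimes> \<epsilon> \<otimes> id \<otimes> \<epsilon>\<close> to the pentagon gives \<open>t\<^sup>2 = t\<close> for \<open>t = (\<epsilon> \<otimes> id \<otimes> \<epsilon>)(\<Phi>)\<close>, and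
  \<open>t\<close> is invertible because \<open>\<Phi>\<close> is.
\<close>

lemma Phi_eps_id_eps: "(\<Sum>(X1, X2, X3)\<leftarrow>terms (Phi H). hscale H (eps H X1 * eps H X3) X2) = 1" (is "?t = 1")
  and PhiInv_eps_id_eps: "(\<Sum>(x1, x2, x3)\<leftarrow>terms (PhiInv H). hscale H (eps H x1 * eps H x3) x2) = 1" (is "?u = 1")
proof -
  have ml: "multilinear (H1 H \<otimes> H1 H \<otimes> H1 H) (\<lambda>(x, y, z). hscale H (eps H x * eps H z) y)"
    by (intro multilinear_tensor multilinear_vs; simp add: distribs eps_simps)
  have "?t * ?u = (\<Sum>(X1, X2, X3)\<leftarrow>terms (Phi H). \<Sum>(x1, x2, x3)\<leftarrow>terms (PhiInv H).
     hscale H (eps H (X1 * x1) * eps H (X3 * x3)) (X2 * x2))"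
    by (simp only: case_prod_unfold sum_list_mult_const[symmetric],
      simp only: sum_list_const_mult[symmetric], simp add: eps_simps hscale_simps mult_ac)
  also have "\<dots> = 1" using Phi_PhiInv_sum[OF ml] by (simp add: eps_simps hscale_simps)
  finally have tu: "?t * ?u = 1" .
  have ml4: "multilinear (H1 H \<otimes> H1 H \<otimes> H1 H \<otimes> H1 H) (\<lambda>(x, y, z, w). hscale H (eps H x * eps H y * eps H w) z)"
    by (intro multilinear_tensor multilinear_vs; simp add: distribs eps_simps)
  have el: "(\<Sum>(h1, h2)\<leftarrow>terms (Delta H h). F (hscale H (eps H h1) h2)) = F h"
    if "\<And>x y. F (x + y) = F x + F y" for F :: "'h \<Rightarrow> 'h" and h using counit_left_apply that .
  have er: "(\<Sum>(h1, h2)\<leftarrow>terms (Delta H h). F (hscale H (eps H h2) h1)) = F h"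
    if "\<And>x y. F (x + y) = F x + F y" for F :: "'h \<Rightarrow> 'h" and h using counit_right_apply that .
  have "?t * ?t = (\<Sum>(X1, X2, X3)\<leftarrow>terms (Phi H). \<Sum>(Y1, Y2, Y3)\<leftarrow>terms (Phi H).
     hscale H (eps H X1 * eps H X3 * (eps H Y1 * eps H Y3)) (X2 * Y2))"
    by (simp only: case_prod_unfold sum_list_mult_const[symmetric],
      simp only: sum_list_const_mult[symmetric], simp add: eps_simps hscale_simps mult_ac)
  also have "\<dots> = (\<Sum>(X1, X2, X3)\<leftarrow>terms (Phi H). \<Sum>(Y1, Y2, Y3)\<leftarrow>terms (Phi H).
      \<Sum>(a, b)\<leftarrow>terms (Delta H Y2).
        hscale H (eps H X1 * eps H X3 * (eps H Y1 * eps H Y3)) (X2 * hscale H (eps H a) b))"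
    by (subst el) (simp_all add: distribs)
  also have "\<dots> = (\<Sum>(X1, X2, X3)\<leftarrow>terms (Phi H). \<Sum>(Y1, Y2, Y3)\<leftarrow>terms (Phi H).
      \<Sum>(a, b)\<leftarrow>terms (Delta H Y2).
        hscale H (eps H X1 * eps H X3 * (eps H Y1 * eps H Y3)) (X2 * hscale H (eps H a) b) *
       (\<Sum>(Z1, Z2, Z3)\<leftarrow>terms (Phi H). hscale H (eps H Z1 * eps H Z2) Z3))"
    by (simp add: Phi_eps_eps_id)
  also have "\<dots> = (\<Sum>(X1, X2, X3)\<leftarrow>terms (Phi H). \<Sum>(Y1, Y2, Y3)\<leftarrow>terms (Phi H).
      \<Sum>(a, b)\<leftarrow>terms (Delta H Y2). \<Sum>(Z1, Z2, Z3)\<leftarrow>terms (Phi H).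
        hscale H (eps H (Y1 * Z1) * eps H (X1 * a * Z2) * eps H (X3 * Y3)) (X2 * b * Z3))"
    by (simp only: case_prod_unfold sum_list_mult_const[symmetric],
      simp only: sum_list_const_mult[symmetric], simp add: eps_simps hscale_simps mult_ac)
  also have "\<dots> = (\<Sum>(X1, X2, X3)\<leftarrow>terms (Phi H). \<Sum>(a, b)\<leftarrow>terms (Delta H X3).
      \<Sum>(Y1, Y2, Y3)\<leftarrow>terms (Phi H). \<Sum>(c, d)\<leftarrow>terms (Delta H Y1).
        hscale H (eps H (X1 * c) * eps H (X2 * d) * eps H (b * Y3)) (a * Y2))"
    by (rule pentagon_sum[OF ml4])
  also have "\<dots> = (\<Sum>(X1, X2, X3)\<leftarrow>terms (Phi H). \<Sum>(a, b)\<leftarrow>terms (Delta H X3).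
      hscale H (eps H X1 * eps H X2) (hscale H (eps H b) a) *
      (\<Sum>(Y1, Y2, Y3)\<leftarrow>terms (Phi H). \<Sum>(c, d)\<leftarrow>terms (Delta H Y1).
        hscale H (eps H (hscale H (eps H c) d) * eps H Y3) Y2))"
    by (simp only: case_prod_unfold sum_list_mult_const[symmetric],
      simp only: sum_list_const_mult[symmetric], simp add: eps_simps hscale_simps mult_ac)
  also have "\<dots> = (\<Sum>(X1, X2, X3)\<leftarrow>terms (Phi H). hscale H (eps H X1 * eps H X2) X3) * ?t"
    by (subst counit_left_apply, simp add: distribs eps_simps, subst er, simp add: distribs eps_simps)
      (simp add: case_prod_unfold sum_list_mult_const)
  also have "\<dots> = ?t" by (simp add: Phi_eps_eps_id)
  finally have tt: "?t * ?t = ?t" .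
  have "?t = ?t * (?t * ?u)" by (simp add: tu)
  also have "\<dots> = ?t * ?u" by (simp only: tt mult.assoc[symmetric])
  finally show t: "?t = 1" by (simp add: tu)
  show "?u = 1" using tu t by simp
qed

end

section \<open>Structure constants of a two-dimensional braided Hopf algebra\<close>

lemma two_nonzero:
  assumes "CHAR('k::field) \<noteq> 2"
  shows "(2 :: 'k) \<noteq> 0"
proof
  assume "(2 :: 'k) = 0"
  then have "of_nat 2 = (0 :: 'k)" by simp
  then have dvd: "CHAR('k) dvd 2" by (simp only: of_nat_eq_0_iff_char_dvd)
  then have "CHAR('k) \<le> 2" by (rule dvd_imp_le) simp
  moreover have "CHAR('k) \<noteq> 0" using dvd by (intro notI) simp
  moreover have "CHAR('k) \<noteq> 1"
    using of_nat_eq_0_iff_char_dvd[of 1, where 'a = 'k] by auto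
  ultimately show False using assms by simp
qed

text \<open>
  A generator \<open>n\<close> of the kernel of the counit, and the functional \<open>\<phi>\<close> that is \<open>1\<close> at \<open>n\<close> and \<open>0\<close> at the
  unit; together with the counit it gives coordinates on \<open>B\<close>.
\<close>

locale two_dimensional = Q: quasi_hopf_algebra H + braided_hopf_algebra H B
  for H :: "('k::field, 'h::ring_1) quasi_hopf" and B :: "('k, 'h, 'b::ab_group_add) braided_hopf" +
  fixes n :: 'b and \<phi> :: "'b \<Rightarrow> 'k"
  assumes phi_linear: "Vector_Spaces.linear (vscale B) (*) \<phi>"
    and decomposition: "b = vscale B (counit B b) (one B) + vscale B (\<phi> b) n"
    and phi_n: "\<phi> n = 1"
    and counit_n: "counit B n = 0"
begin

sublocale V: vector_space "vscale B" by (rule vector_space)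

lemmas phi_simps = linear_functionalD[OF phi_linear] phi_n
lemmas counit_simps = linear_functionalD[OF counit_linear] counit_one counit_n counit_act counit_mul
lemmas act_simps = linear_functionalD[OF act_linear] act_add act_scale
lemmas mul_simps = linear_functionalD[OF mul_linear_left] linear_functionalD[OF mul_linear_right]
lemmas vscale_simps = V.scale_right_distrib V.scale_left_distrib V.scale_scale
lemmas hscale_simps = Q.hscale_simps
lemmas eps_simps = Q.eps_simps

lemma phi_zero: "\<phi> 0 = 0" and counit_zero: "counit B 0 = 0"
  using linear_zero[OF phi_linear] linear_zero[OF counit_linear] .

lemma phi_one: "\<phi> (one B) = 0"
proof -
  have "vscale B (\<phi> (one B)) n = 0" using decomposition[of "one B"] by (simp add: counit_one)
  then have "\<phi> (vscale B (\<phi> (one B)) n) = \<phi> 0" by (rule arg_cong)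
  then show ?thesis by (simp add: phi_simps(2,3) phi_zero)
qed

lemma coordinates_eqI: "counit B x = counit B y \<Longrightarrow> \<phi> x = \<phi> y \<Longrightarrow> x = y"
  using decomposition[of x] decomposition[of y] by simp

definition \<sigma> :: "'h \<Rightarrow> 'k" where "\<sigma> h = \<phi> (act B h n)"

lemma act_n: "act B h n = vscale B (\<sigma> h) n"
  by (rule coordinates_eqI) (simp_all add: counit_simps phi_simps \<sigma>_def)

lemma sigma_character: "character (hscale H) \<sigma>"
proof -
  interpret A: vector_space "hscale H" using Q.algebra by (simp add: k_algebra_def)
  have "\<sigma> (g * h) = \<sigma> g * \<sigma> h" for g h
    by (simp add: \<sigma>_def act_mult) (simp add: act_n act_simps phi_simps mult.commute)
  moreover have "Vector_Spaces.linear (hscale H) (*) \<sigma>"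
    by unfold_locales (simp_all add: \<sigma>_def act_simps phi_simps algebra_simps)
  ultimately show ?thesis by (simp add: character_def) (simp add: \<sigma>_def act_one phi_n)
qed

lemmas sigma_simps = characterD[OF sigma_character]

text \<open>
  The image of the coaction of \<open>n\<close> under \<open>id \<otimes> \<phi>\<close>; \<open>coact_n\<close> shows that nothing else is left of this
  coaction.
\<close>

definition v :: 'h where "v = (\<Sum>(g, m)\<leftarrow>terms (coact B n). hscale H (\<phi> m) g)"

lemma algebra_vector_space: "vector_space (hscale H)"
  using Q.algebra by (simp add: k_algebra_def)

lemmas B_distribs = Q.distribs phi_simps counit_simps act_simps mul_simps vscale_simps sigma_simps
  eps_simps distrib_left distrib_right sum_list_addf

text \<open>
  The component of the coaction along \<open>1\<close> is \<open>(id \<otimes> \<epsilon>)\<close> of it, which vanishes because the counit is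
  colinear and \<open>\<epsilon>(n) = 0\<close>.
\<close>

lemma coact_n: "coact B n = cls (H1 H \<otimes> V1 B) [(v, n)]"
proof -
  have "teq (H1 H \<otimes> V1 B) (terms (coact B n)) [(v, n)]"
  proof (rule teq_vs_tensorI[OF algebra_vector_space vector_space])
    fix f assume f: "Vector_Spaces.linear (hscale H) (*) f"
    note f_simps = linear_functionalD[OF f]
    have f0: "f 0 = 0" by (rule linear_zero[OF f])
    have fsum: "f (\<Sum>t\<leftarrow>ts. F t) = (\<Sum>t\<leftarrow>ts. f (F t))" for F and ts :: "('h \<times> 'b) list"
      by (induction ts) (simp_all add: f_simps f0)
    have csum: "counit B (\<Sum>t\<leftarrow>ts. F t) = (\<Sum>t\<leftarrow>ts. counit B (F t))"
      and psum: "\<phi> (\<Sum>t\<leftarrow>ts. F t) = (\<Sum>t\<leftarrow>ts. \<phi> (F t))" for F and ts :: "('h \<times> 'b) list"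
      by (induction ts) (simp_all add: counit_simps phi_simps phi_zero counit_zero)
    have "(\<Sum>(g, m)\<leftarrow>terms (coact B n). f g * counit B m) = 0"
      using arg_cong[OF counit_coact[of n], of f]
      by (simp add: case_prod_unfold fsum f_simps f0 counit_n hscale_simps mult.commute)
    moreover have "(\<Sum>(g, m)\<leftarrow>terms (coact B n). f g * \<phi> m) = f v"
      by (simp add: v_def case_prod_unfold fsum f_simps mult.commute)
    ultimately show "(\<Sum>(x, y)\<leftarrow>terms (coact B n). vscale B (f x) y) = (\<Sum>(x, y)\<leftarrow>[(v, n)]. vscale B (f x) y)"
      by (intro coordinates_eqI) (simp_all add: case_prod_unfold csum psum counit_simps phi_simps)
  qed
  then show ?thesis
    using linear_into_cls[OF coact_linear, of n] by (simp add: cls_eq_iff[symmetric])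
qed

lemma coact_sum:
  assumes "multilinear (H1 H \<otimes> V1 B) (\<lambda>(g, m). F g m)"
  shows "(\<Sum>(g, m)\<leftarrow>terms (coact B b). F g m) =
    F 1 (vscale B (counit B b) (one B)) + F v (vscale B (\<phi> b) n)"
proof -
  note F = multilinear_vs_tensorD[OF assms, simplified]
  have scale: "(\<Sum>(g, m)\<leftarrow>terms (coact B (vscale B c x)). F g m) =
    (\<Sum>(g, m)\<leftarrow>terms (coact B x). F g (vscale B c m))" for c x
    using linear_into_scale[OF coact_linear assms, of c x]
    by (simp add: case_prod_unfold fst_tensor fst_vs F)
  have ml: "multilinear (H1 H \<otimes> V1 B) (\<lambda>(g, m). F g (vscale B c m))" for c
    by (intro multilinear_tensor multilinear_vs)
      (simp_all add: F V.scale_right_distrib V.scale_scale mult.commute fst_vs)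
  have "(\<Sum>(g, m)\<leftarrow>terms (coact B b). F g m) =
    (\<Sum>(g, m)\<leftarrow>terms (coact B (vscale B (counit B b) (one B) + vscale B (\<phi> b) n)). F g m)"
    by (simp only: decomposition[of b, symmetric])
  then show ?thesis
    using linear_into_add[OF coact_linear assms] sum_terms[OF one_coact ml] sum_terms[OF coact_n ml]
    by (simp add: scale)
qed

lemma counit_sum_list: "counit B (\<Sum>t\<leftarrow>ts. G t) = (\<Sum>t\<leftarrow>ts. counit B (G t))"
  and phi_sum_list: "\<phi> (\<Sum>t\<leftarrow>ts. G t) = (\<Sum>t\<leftarrow>ts. \<phi> (G t))"
  by (induction ts) (simp_all add: counit_simps phi_simps phi_zero counit_zero)

definition \<kappa> :: 'k where "\<kappa> = (\<Sum>(x, y)\<leftarrow>terms (comul B n). \<phi> x * \<phi> y)"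

text \<open>
  The two counit axioms determine all coefficients except that of \<open>n \<otimes> n\<close>.
\<close>

lemma comul_n:
  "comul B n = cls (V1 B \<otimes> V1 B) [(n, one B), (one B, n), (vscale B \<kappa> n, n)]" (is "_ = cls _ ?u")
proof -
  have "teq (V1 B \<otimes> V1 B) (terms (comul B n)) ?u"
  proof (rule teq_vs_tensorI[OF vector_space vector_space])
    fix f assume f: "Vector_Spaces.linear (vscale B) (*) f"
    note f_simps = linear_functionalD[OF f]
    have f0: "f 0 = 0" by (rule linear_zero[OF f])
    have fsum: "f (\<Sum>t\<leftarrow>ts. F t) = (\<Sum>t\<leftarrow>ts. f (F t))" for F and ts :: "('b \<times> 'b) list"
      by (induction ts) (simp_all add: f_simps f0)
    have f_coords: "f x = counit B x * f (one B) + \<phi> x * f n" for x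
      using arg_cong[OF decomposition[of x], of f] by (simp add: f_simps)
    have left: "(\<Sum>(x, y)\<leftarrow>terms (comul B n). f x * counit B y) = f n"
      using arg_cong[OF counit_right[of n], of f] by (simp add: case_prod_unfold fsum f_simps mult.commute)
    have "(\<Sum>(x, y)\<leftarrow>terms (comul B n). counit B x * \<phi> y) = 1"
      using arg_cong[OF counit_left[of n], of \<phi>] by (simp add: case_prod_unfold phi_sum_list phi_simps)
    then have right: "(\<Sum>(x, y)\<leftarrow>terms (comul B n). f x * \<phi> y) = f (one B) + \<kappa> * f n"
    proof -
      have "(\<Sum>(x, y)\<leftarrow>terms (comul B n). f x * \<phi> y) = (\<Sum>(x, y)\<leftarrow>terms (comul B n).
          f (one B) * (counit B x * \<phi> y) + f n * (\<phi> x * \<phi> y))"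
        by (subst f_coords) (simp add: case_prod_unfold algebra_simps)
      with \<open>_ = 1\<close> show ?thesis
        by (simp add: case_prod_unfold \<kappa>_def sum_list_addf sum_list_const_mult)
    qed
    show "(\<Sum>(x, y)\<leftarrow>terms (comul B n). vscale B (f x) y) = (\<Sum>(x, y)\<leftarrow>?u. vscale B (f x) y)"
      using left right
      by (intro coordinates_eqI) (simp_all add: case_prod_unfold counit_sum_list phi_sum_list
        counit_simps phi_simps f_simps phi_one)
  qed
  then show ?thesis
    using linear_into_cls[OF comul_linear, of n] by (simp add: cls_eq_iff[symmetric])
qed

lemma comul_sum:
  assumes "multilinear (V1 B \<otimes> V1 B) (\<lambda>(x, y). F x y)"
  shows "(\<Sum>(x, y)\<leftarrow>terms (comul B b). F x y) =
    F (vscale B (counit B b) (one B)) (one B) +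
    (F (vscale B (\<phi> b) n) (one B) + F (vscale B (\<phi> b) (one B)) n + F (vscale B (\<phi> b * \<kappa>) n) n)"
proof -
  note F = multilinear_vs_tensorD[OF assms, simplified]
  have scale: "(\<Sum>(x, y)\<leftarrow>terms (comul B (vscale B c z)). F x y) =
    (\<Sum>(x, y)\<leftarrow>terms (comul B z). F (vscale B c x) y)" for c z
    using linear_into_scale[OF comul_linear assms, of c z]
    by (simp add: case_prod_unfold fst_tensor fst_vs)
  have ml: "multilinear (V1 B \<otimes> V1 B) (\<lambda>(x, y). F (vscale B c x) y)" for c
    by (intro multilinear_tensor multilinear_vs)
      (simp_all add: F V.scale_right_distrib V.scale_scale mult.commute fst_vs)
  have "(\<Sum>(x, y)\<leftarrow>terms (comul B b). F x y) =
    (\<Sum>(x, y)\<leftarrow>terms (comul B (vscale B (counit B b) (one B) + vscale B (\<phi> b) n)). F x y)"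
    by (simp only: decomposition[of b, symmetric])
  then show ?thesis
    using linear_into_add[OF comul_linear assms] sum_terms[OF comul_one ml] sum_terms[OF comul_n ml]
    by (simp add: scale add.assoc)
qed

definition \<mu> :: 'k where "\<mu> = \<phi> (mul B n n)"

lemma mul_n_n: "mul B n n = vscale B \<mu> n"
  by (rule coordinates_eqI) (simp_all add: counit_simps phi_simps \<mu>_def)

lemma phi_mul: "\<phi> (mul B x y) = counit B x * \<phi> y + \<phi> x * counit B y + \<phi> x * \<phi> y * \<mu>"
proof -
  have "mul B x y = mul B (vscale B (counit B x) (one B) + vscale B (\<phi> x) n)
      (vscale B (counit B y) (one B) + vscale B (\<phi> y) n)"
    by (simp only: decomposition[symmetric])
  then show ?thesis
    by (simp add: mul_simps one_mul mul_one mul_n_n phi_simps phi_one algebra_simps)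
qed

lemma phi_act: "\<phi> (act B h x) = \<sigma> h * \<phi> x"
proof -
  have "\<phi> (act B h x) = \<phi> (act B h (vscale B (counit B x) (one B) + vscale B (\<phi> x) n))"
    by (simp only: decomposition[symmetric])
  then show ?thesis
    by (simp add: act_simps one_act act_n phi_simps phi_one)
qed

text \<open>
  \<open>h \<cdot> n\<^sup>2 = (h\<^sub>1 \<cdot> n)(h\<^sub>2 \<cdot> n)\<close> gives \<open>\<mu> \<sigma> = \<mu> (\<sigma> * \<sigma>)\<close>, and comparing the coefficients of \<open>n \<otimes> n\<close> in
  \<open>\<Delta>(h \<cdot> n) = h \<cdot> \<Delta>(n)\<close> gives \<open>\<kappa> \<sigma> = \<kappa> (\<sigma> * \<sigma>)\<close>.
\<close>

lemma sigma_eq_eps: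
  assumes "\<mu> \<noteq> 0 \<or> \<kappa> \<noteq> 0"
  shows "\<sigma> = eps H"
proof (rule Q.idempotent_character_eq_eps[OF sigma_character])
  fix h
  let ?s = "\<Sum>(h1, h2)\<leftarrow>terms (Delta H h). \<sigma> h1 * \<sigma> h2"
  have "\<phi> (act B h (mul B n n)) = \<mu> * ?s"
    by (subst mul_act) (simp add: act2_def case_prod_unfold phi_sum_list comp_def act_n mul_simps mul_n_n
      phi_simps sum_list_mult_const mult_ac flip: sum_list_const_mult)
  then have \<mu>: "\<mu> * \<sigma> h = \<mu> * ?s" by (simp add: mul_n_n act_simps act_n phi_simps mult_ac)
  have ml: "multilinear (V1 B \<otimes> V1 B) (\<lambda>(x, y). \<phi> x * \<phi> y)"
    "multilinear (V1 B \<otimes> V1 B) (\<lambda>(x, y). \<Sum>(h1, h2)\<leftarrow>terms (Delta H h). \<phi> (act B h1 x) * \<phi> (act B h2 y))"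
    by (intro multilinear_tensor multilinear_vs; simp add: B_distribs)+
  have "\<kappa> * \<sigma> h = (\<Sum>(x, y)\<leftarrow>terms (comul B (act B h n)). \<phi> x * \<phi> y)"
    using comul_sum[OF ml(1)] by (simp add: act_n phi_simps phi_one mult_ac)
  also have "\<dots> = (\<Sum>(x, y)\<leftarrow>terms (comul B n). \<Sum>(h1, h2)\<leftarrow>terms (Delta H h). \<phi> (act B h1 x) * \<phi> (act B h2 y))"
    using sum_terms[OF comul_act ml(1)]
    by (simp add: sum_list_concat_map act2_def comp_def case_prod_unfold)
  also have "\<dots> = \<kappa> * ?s"
    by (subst comul_sum[OF ml(2)])
     (simp add: case_prod_unfold phi_act phi_simps phi_one mult_ac counit_simps flip: sum_list_const_mult)
  finally show "?s = \<sigma> h" using \<mu> assms by auto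
qed

section \<open>The coaction and its element v\<close>

lemma eps_v: "eps H v = 1"
proof -
  have "multilinear (H1 H \<otimes> V1 B) (\<lambda>(g, m). vscale B (eps H g) m)"
    by (intro multilinear_tensor multilinear_vs; simp add: B_distribs)
  from coact_sum[OF this, of n] have "n = vscale B (eps H v) n"
    by (simp add: coact_counit counit_simps phi_simps)
  then have "\<phi> n = \<phi> (vscale B (eps H v) n)" by simp
  then show ?thesis by (simp add: phi_simps)
qed

text \<open>
  The compatibility of action and coaction at \<open>n\<close>, with the factor \<open>n\<close> stripped off by \<open>id \<otimes> \<phi>\<close>.
\<close>

lemma sigma_v_commute: "(\<Sum>(h1, h2)\<leftarrow>terms (Delta H h). hscale H (\<sigma> h2) (h1 * v)) =
             (\<Sum>(h1, h2)\<leftarrow>terms (Delta H h). hscale H (\<sigma> h1) (v * h2))"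
proof -
  have ml: "multilinear (H1 H \<otimes> V1 B) (\<lambda>(g, m). hscale H (\<phi> m) g)"
    by (intro multilinear_tensor multilinear_vs; simp add: B_distribs)
  have ml2: "multilinear (H1 H \<otimes> V1 B) (\<lambda>(g, m). hscale H (\<sigma> k * \<phi> m) (l * g))"
     "multilinear (H1 H \<otimes> V1 B) (\<lambda>(g, m). hscale H (\<phi> m) (g * l))" for k l
    by (intro multilinear_tensor multilinear_vs; simp add: B_distribs)+
  from cls_sum_eq[OF act_coact[where h=h and m=n] ml] show ?thesis
    by (simp add: sum_list_concat_map comp_def case_prod_unfold
      coact_sum[OF ml2(1), unfolded case_prod_unfold] coact_sum[OF ml2(2), unfolded case_prod_unfold]
      phi_act phi_simps phi_one phi_zero counit_simps hscale_simps act_n)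
qed

text \<open>
  At \<open>n\<close>, the quasi-coassociativity of the coaction reads
  \<open>\<sigma>(X\<^sup>2) X\<^sup>1 v \<otimes> v X\<^sup>3 = \<sigma>(X\<^sup>3) \<sigma>(Y\<^sup>1) X\<^sup>1 v\<^sub>1 Y\<^sup>2 \<otimes> X\<^sup>2 v\<^sub>2 Y\<^sup>3\<close>, that is, \<open>P \<Delta>(v) Q\<close> is known for
  \<open>P = \<sigma>(X\<^sup>3) X\<^sup>1 \<otimes> X\<^sup>2\<close> and \<open>Q = \<sigma>(Y\<^sup>1) Y\<^sup>2 \<otimes> Y\<^sup>3\<close>.  Both are invertible, with inverses
  \<open>\<sigma>(x\<^sup>3) x\<^sup>1 \<otimes> x\<^sup>2\<close> and \<open>\<sigma>(y\<^sup>1) y\<^sup>2 \<otimes> y\<^sup>3\<close>.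
\<close>

lemma Delta_v:
  "Delta H v = cls (H1 H \<otimes> H1 H)
    [(hscale H (\<sigma> (x3 * X2 * y1)) (x1 * X1 * v * y2), x2 * v * X3 * y3).
       (x1, x2, x3) \<leftarrow> terms (PhiInv H), (X1, X2, X3) \<leftarrow> terms (Phi H),
       (y1, y2, y3) \<leftarrow> terms (PhiInv H)]" (is "_ = cls _ ?u")
proof -
  have "teq (H1 H \<otimes> H1 H) (terms (Delta H v)) ?u"
  proof (rule teq_vs_tensorI[OF algebra_vector_space algebra_vector_space])
    fix f assume f: "Vector_Spaces.linear (hscale H) (*) f"
    note f_simps = linear_functionalD[OF f]
    \<comment> \<open>\<open>F\<close> multiplies \<open>g \<otimes> l\<close> by the inverses of \<open>P\<close> and \<open>Q\<close> before \<open>f \<otimes> id\<close> is applied.\<close>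
    define F where "F g l m = (\<Sum>(x1, x2, x3)\<leftarrow>terms (PhiInv H). \<Sum>(y1, y2, y3)\<leftarrow>terms (PhiInv H).
      hscale H (\<sigma> x3 * \<sigma> y1 * \<phi> m * f (x1 * g * y2)) (x2 * l * y3))" for g l m
    have ml: "multilinear (H1 H \<otimes> H1 H \<otimes> V1 B) (\<lambda>(g, l, m). F g l m)"
      unfolding F_def by (intro multilinear_tensor multilinear_vs; simp add: B_distribs f_simps)
    have F0: "F g l m = 0" if "\<phi> m = 0" for g l m
      by (simp add: F_def that hscale_simps case_prod_unfold)
    have left: "(\<Sum>(X1, X2, X3)\<leftarrow>terms (Phi H). \<Sum>(g, m)\<leftarrow>terms (coact B n).
        \<Sum>(l, m')\<leftarrow>terms (coact B (act B X2 m)). F (X1 * g) (l * X3) m') =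
      (\<Sum>(X1, X2, X3)\<leftarrow>terms (Phi H). F (X1 * v) (v * X3) (vscale B (\<sigma> X2) n))"
    proof -
      have inner: "(\<Sum>(l, m')\<leftarrow>terms (coact B b). F g (l * k) m') = F g (v * k) (vscale B (\<phi> b) n)" for g k b
      proof -
        have "multilinear (H1 H \<otimes> V1 B) (\<lambda>(l, m'). F g (l * k) m')"
          unfolding F_def by (intro multilinear_tensor multilinear_vs; simp add: B_distribs f_simps)
        from coact_sum[OF this] show ?thesis by (simp add: F0 phi_simps phi_one phi_zero counit_n)
      qed
      have outer: "(\<Sum>(g, m)\<leftarrow>terms (coact B n). F (k * g) l (vscale B (c * \<phi> m) n)) = F (k * v) l (vscale B c n)" for k l c
      proof -
        have "multilinear (H1 H \<otimes> V1 B) (\<lambda>(g, m). F (k * g) l (vscale B (c * \<phi> m) n))"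
          unfolding F_def by (intro multilinear_tensor multilinear_vs; simp add: B_distribs f_simps)
        from coact_sum[OF this] show ?thesis by (simp add: F0 phi_simps phi_one phi_zero counit_n)
      qed
      show ?thesis
        using outer by (simp add: inner[unfolded case_prod_unfold] phi_act case_prod_unfold)
    qed
    have right: "(\<Sum>(X1, X2, X3)\<leftarrow>terms (Phi H). \<Sum>(Y1, Y2, Y3)\<leftarrow>terms (Phi H).
        \<Sum>(g, m)\<leftarrow>terms (coact B (act B Y1 n)). \<Sum>(g1, g2)\<leftarrow>terms (Delta H g).
          F (X1 * g1 * Y2) (X2 * g2 * Y3) (act B X3 m)) =
      (\<Sum>(X1, X2, X3)\<leftarrow>terms (Phi H). \<Sum>(Y1, Y2, Y3)\<leftarrow>terms (Phi H).
        \<Sum>(g1, g2)\<leftarrow>terms (Delta H v).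
          F (X1 * g1 * Y2) (X2 * g2 * Y3) (vscale B (\<sigma> X3 * \<sigma> Y1) n))"
    proof -
      have "(\<Sum>(g, m)\<leftarrow>terms (coact B b). \<Sum>(g1, g2)\<leftarrow>terms (Delta H g). F (k * g1 * k') (l * g2 * l') (act B h m)) =
        (\<Sum>(g1, g2)\<leftarrow>terms (Delta H v). F (k * g1 * k') (l * g2 * l') (vscale B (\<sigma> h * \<phi> b) n))" for b k k' l l' h
      proof -
        have mlD: "multilinear (H1 H \<otimes> H1 H) (\<lambda>(g1, g2). F (k * g1 * k') (l * g2 * l') m)" for m
          unfolding F_def by (intro multilinear_tensor multilinear_vs; simp add: B_distribs f_simps)
        have "multilinear (H1 H \<otimes> V1 B) (\<lambda>(g, m). \<Sum>(g1, g2)\<leftarrow>terms (Delta H g). F (k * g1 * k') (l * g2 * l') (act B h m))"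
        proof (intro multilinear_tensor multilinear_vs, goal_cases)
          case (1 m x y)
          then show ?case using linear_into_add[OF Q.Delta_linear mlD] by simp
        next
          case (2 g x y)
          then show ?case by (simp add: F_def B_distribs)
        next
          case (3 c g m)
          then show ?case
            using linear_into_scale[OF Q.Delta_linear mlD[of "act B h m"], of c g]
            by (simp add: fst_vs fst_tensor case_prod_unfold) (simp add: F_def B_distribs f_simps)
        qed
        from coact_sum[OF this] show ?thesis by (simp add: F0 phi_simps phi_act phi_one act_simps act_n case_prod_unfold mult_ac)
      qed
      then show ?thesis by (simp add: case_prod_unfold act_n phi_simps)
    qed
    have "(\<Sum>(X1, X2, X3)\<leftarrow>terms (Phi H). F (X1 * v) (v * X3) (vscale B (\<sigma> X2) n)) =
      (\<Sum>(X1, X2, X3)\<leftarrow>terms (Phi H). \<Sum>(Y1, Y2, Y3)\<leftarrow>terms (Phi H).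
        \<Sum>(g1, g2)\<leftarrow>terms (Delta H v).
          F (X1 * g1 * Y2) (X2 * g2 * Y3) (vscale B (\<sigma> X3 * \<sigma> Y1) n))"
      using cls_sum_eq[OF coact_quasi_coassoc[of n] ml] left right
      by (simp add: sum_list_concat_map comp_def case_prod_unfold)
    also have "\<dots> = (\<Sum>(g1, g2)\<leftarrow>terms (Delta H v). \<Sum>(x1, x2, x3)\<leftarrow>terms (PhiInv H).
        \<Sum>(X1, X2, X3)\<leftarrow>terms (Phi H). \<Sum>(Y1, Y2, Y3)\<leftarrow>terms (Phi H). \<Sum>(y1, y2, y3)\<leftarrow>terms (PhiInv H).
          hscale H (\<sigma> (x3 * X3) * \<sigma> (Y1 * y1) * f ((x1 * X1) * g1 * (Y2 * y2))) ((x2 * X2) * g2 * (Y3 * y3)))"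
      \<comment> \<open>These instances of the exchange of sums lead both sides to the same order: first the copies of
        \<open>\<Phi>\<close>, then those of its inverse, and \<open>\<Delta>(v)\<close> last.\<close>
      unfolding F_def case_prod_unfold
        sum_list_swap[of _ "terms (Phi H)" "terms (PhiInv H)"] sum_list_swap[of _ _ "terms (Delta H v)"]
      by (simp add: sigma_simps phi_simps mult_ac)
    also have "\<dots> = (\<Sum>(g1, g2)\<leftarrow>terms (Delta H v). hscale H (f g1) g2)"
    proof -
      have "(\<Sum>(x1, x2, x3)\<leftarrow>terms (PhiInv H).
        \<Sum>(X1, X2, X3)\<leftarrow>terms (Phi H). \<Sum>(Y1, Y2, Y3)\<leftarrow>terms (Phi H). \<Sum>(y1, y2, y3)\<leftarrow>terms (PhiInv H).
          hscale H (\<sigma> (x3 * X3) * \<sigma> (Y1 * y1) * f ((x1 * X1) * g1 * (Y2 * y2))) ((x2 * X2) * g2 * (Y3 * y3))) =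
        hscale H (f g1) g2" for g1 g2
      proof -
        have mlP: "multilinear (H1 H \<otimes> H1 H \<otimes> H1 H) (\<lambda>(p, q, r). \<Sum>(Y1, Y2, Y3)\<leftarrow>terms (Phi H). \<Sum>(y1, y2, y3)\<leftarrow>terms (PhiInv H).
          hscale H (\<sigma> r * \<sigma> (Y1 * y1) * f (p * g1 * (Y2 * y2))) (q * g2 * (Y3 * y3)))"
          by (intro multilinear_tensor multilinear_vs; simp add: B_distribs f_simps)
        have mlQ: "multilinear (H1 H \<otimes> H1 H \<otimes> H1 H) (\<lambda>(p, q, r). hscale H (\<sigma> p * f (g1 * q)) (g2 * r))"
          by (intro multilinear_tensor multilinear_vs; simp add: B_distribs f_simps)
        show ?thesis
          unfolding Q.PhiInv_Phi_sum[OF mlP] using Q.Phi_PhiInv_sum[OF mlQ] by (simp add: sigma_simps)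
      qed
      then show ?thesis by simp
    qed
    finally show "(\<Sum>(x, y)\<leftarrow>terms (Delta H v). hscale H (f x) y) = (\<Sum>(x, y)\<leftarrow>?u. hscale H (f x) y)"
      unfolding F_def case_prod_unfold sum_list_concat_map sum_list_swap[of _ "terms (Phi H)" "terms (PhiInv H)"]
      by (simp add: comp_def sum_list_concat_map case_prod_unfold phi_simps f_simps sigma_simps mult_ac)
  qed
  then show ?thesis
    using linear_into_cls[OF Q.Delta_linear, of v] by (simp add: cls_eq_iff[symmetric])
qed

lemma v_central:
  assumes "\<sigma> = eps H"
  shows "h * v = v * h"
  using sigma_v_commute[of h] Q.counit_left_apply[of "\<lambda>x. v * x" h] Q.counit_right_apply[of "\<lambda>x. x * v" h]
  by (simp add: assms hscale_simps distrib_left distrib_right)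

text \<open>
  With \<open>v\<close> central, the formula for \<open>\<Delta>(v)\<close> shows that \<open>\<alpha> = S(v\<^sub>1)\<alpha>v\<^sub>2\<close> is a left multiple \<open>c v\<close> of \<open>v\<close>;
  then so is \<open>1 = X\<^sup>1\<beta>S(X\<^sup>2)\<alpha>X\<^sup>3\<close>.
\<close>

lemma v_left_inverse:
  assumes "\<sigma> = eps H"
  shows "\<exists>w. w * v = 1"
proof -
  note central = v_central[OF assms]
  define c where "c = (\<Sum>(x1, x2, x3)\<leftarrow>terms (PhiInv H). \<Sum>(X1, X2, X3)\<leftarrow>terms (Phi H).
       \<Sum>(y1, y2, y3)\<leftarrow>terms (PhiInv H). hscale H (\<sigma> (x3 * X2 * y1))
         (antipode H (x1 * X1 * v * y2) * alpha H * x2 * X3 * y3))"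
  have ml: "multilinear (H1 H \<otimes> H1 H) (\<lambda>(x, y). antipode H x * alpha H * y)"
    by (intro multilinear_tensor multilinear_vs; simp add: Q.distribs Q.antipode_simps)
  have v: "k * alpha H * (x2 * v * X3 * y3) = k * alpha H * x2 * X3 * y3 * v" for k x2 X3 y3
    by (metis central mult.assoc)
  have "alpha H = c * v"
    using Q.antipode_alpha[of v] sum_terms[OF Delta_v ml]
    by (simp add: eps_v hscale_simps c_def sum_list_concat_map case_prod_unfold comp_def v
      Q.antipode_simps flip: sum_list_mult_const)
  moreover have "X * (c * v) * Y = X * c * Y * v" for X Y by (metis central mult.assoc)
  ultimately have "(\<Sum>(X1, X2, X3)\<leftarrow>terms (Phi H). X1 * beta H * antipode H X2 * c * X3) * v = 1"
    using Q.antipode_Phi by (simp add: case_prod_unfold flip: sum_list_mult_const)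
  then show ?thesis ..
qed

text \<open>
  Colinearity of the product at \<open>n \<otimes> n\<close>: as \<open>\<sigma> = \<epsilon>\<close>, the coaction of \<open>n\<^sup>2 = \<mu> n\<close> is
  \<open>X\<^sup>1 v x\<^sup>2 v Y\<^sup>3 \<otimes> \<mu> n\<close> with \<open>\<epsilon>\<close> applied to all other legs, and these reassociators collapse to \<open>1\<close>.
\<close>

lemma v_idempotent:
  assumes "\<mu> \<noteq> 0"
  shows "v * v = v"
proof -
  have eps: "\<sigma> = eps H" using sigma_eq_eps assms by simp
  have ml: "multilinear (H1 H \<otimes> V1 B) (\<lambda>(g, m). hscale H (\<phi> m) g)"
    by (intro multilinear_tensor multilinear_vs; simp add: B_distribs)
  have inner: "(\<Sum>(l, y)\<leftarrow>terms (coact B b). hscale H (\<phi> (mul B x (act B h y))) (k * l * k')) =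
      hscale H (eps H h * \<phi> b * \<phi> (mul B x n)) (k * v * k')" if "counit B b = 0" for b h k k' x
  proof -
    have "multilinear (H1 H \<otimes> V1 B) (\<lambda>(l, y). hscale H (\<phi> (mul B x (act B h y))) (k * l * k'))"
      by (intro multilinear_tensor multilinear_vs; simp add: B_distribs)
    from coact_sum[OF this] show ?thesis
      using that by (simp add: phi_mul phi_act counit_simps phi_simps phi_one phi_zero eps hscale_simps algebra_simps)
  qed
  have outer: "(\<Sum>(g, x)\<leftarrow>terms (coact B b). hscale H (c * \<phi> (mul B (act B h x) n)) (k * g * k' * v * l)) =
      hscale H (c * eps H h * \<phi> b * \<mu>) (k * v * k' * v * l)" if "counit B b = 0" for b h c k k' l
  proof -
    have "multilinear (H1 H \<otimes> V1 B) (\<lambda>(g, x). hscale H (c * \<phi> (mul B (act B h x) n)) (k * g * k' * v * l))"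
      by (intro multilinear_tensor multilinear_vs; simp add: B_distribs)
    from coact_sum[OF this] show ?thesis
      using that by (simp add: phi_mul phi_act counit_simps phi_simps phi_one phi_zero eps hscale_simps algebra_simps)
  qed
  have "hscale H \<mu> v = (\<Sum>(g, m)\<leftarrow>terms (coact B (mul B n n)). hscale H (\<phi> m) g)"
    by (subst coact_sum[OF ml]) (simp add: mul_n_n counit_simps phi_simps phi_one phi_zero hscale_simps)
  also have "\<dots> = (\<Sum>(g, x, y)\<leftarrow>coact2 H B B (n, n). hscale H (\<phi> (mul B x y)) g)"
    using sum_terms[OF mul_coact ml] by (simp add: case_prod_unfold comp_def)
  also have "\<dots> = (\<Sum>(X1, X2, X3)\<leftarrow>terms (Phi H). \<Sum>(x1, x2, x3)\<leftarrow>terms (PhiInv H).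
      \<Sum>(Y1, Y2, Y3)\<leftarrow>terms (Phi H).
      hscale H (\<mu> * (eps H X2 * eps H X3 * (eps H x1 * eps H x3 * (eps H Y1 * eps H Y2)))) (X1 * v * x2 * v * Y3))"
  proof -
    have "(\<Sum>(g, x, y)\<leftarrow>coact2 H B B (n, n). hscale H (\<phi> (mul B x y)) g) =
      (\<Sum>(X1, X2, X3)\<leftarrow>terms (Phi H). \<Sum>(x1, x2, x3)\<leftarrow>terms (PhiInv H). \<Sum>(Y1, Y2, Y3)\<leftarrow>terms (Phi H).
        \<Sum>(g, x)\<leftarrow>terms (coact B (act B (x1 * Y1) n)). \<Sum>(l, y)\<leftarrow>terms (coact B (act B Y2 n)).
          hscale H (\<phi> (mul B (act B X2 x) (act B (X3 * x3) y))) (X1 * g * x2 * l * Y3))"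
      by (simp add: coact2_def sum_list_concat_map case_prod_unfold comp_def)
    also have "\<dots> = (\<Sum>(X1, X2, X3)\<leftarrow>terms (Phi H). \<Sum>(x1, x2, x3)\<leftarrow>terms (PhiInv H). \<Sum>(Y1, Y2, Y3)\<leftarrow>terms (Phi H).
        \<Sum>(g, x)\<leftarrow>terms (coact B (act B (x1 * Y1) n)).
          hscale H (eps H (X3 * x3) * \<phi> (act B Y2 n) * \<phi> (mul B (act B X2 x) n)) (X1 * g * x2 * v * Y3))"
      by (simp add: inner counit_simps)
    also have "\<dots> = (\<Sum>(X1, X2, X3)\<leftarrow>terms (Phi H). \<Sum>(x1, x2, x3)\<leftarrow>terms (PhiInv H). \<Sum>(Y1, Y2, Y3)\<leftarrow>terms (Phi H).
          hscale H (eps H (X3 * x3) * \<phi> (act B Y2 n) * eps H X2 * \<phi> (act B (x1 * Y1) n) * \<mu>) (X1 * v * x2 * v * Y3))"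
      by (simp add: outer counit_simps)
    finally show ?thesis
      by (simp add: phi_act eps phi_n eps_simps mult_ac)
  qed
  also have "\<dots> = hscale H \<mu> ((\<Sum>(X1, X2, X3)\<leftarrow>terms (Phi H). hscale H (eps H X2 * eps H X3) X1) * (v *
     ((\<Sum>(x1, x2, x3)\<leftarrow>terms (PhiInv H). hscale H (eps H x1 * eps H x3) x2) * (v *
     (\<Sum>(Y1, Y2, Y3)\<leftarrow>terms (Phi H). hscale H (eps H Y1 * eps H Y2) Y3)))))"
  proof -
    have out: "hscale H c (\<Sum>x\<leftarrow>xs. F x) = (\<Sum>x\<leftarrow>xs. hscale H c (F x))" for c F and xs :: "('h \<times> 'h \<times> 'h) list"
      by (induction xs) (simp_all add: hscale_simps)
    show ?thesis
      by (simp only: case_prod_unfold sum_list_mult_const[symmetric], simp only: sum_list_const_mult[symmetric],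
        simp add: out hscale_simps mult_ac)
  qed
  also have "\<dots> = hscale H \<mu> (v * v)"
    by (simp add: Q.Phi_id_eps_eps Q.PhiInv_eps_id_eps Q.Phi_eps_eps_id)
  finally have "hscale H (1 / \<mu>) (hscale H \<mu> v) = hscale H (1 / \<mu>) (hscale H \<mu> (v * v))" by simp
  then show ?thesis using assms by (simp add: hscale_simps)
qed

lemma v_eq_one:
  assumes "\<mu> \<noteq> 0"
  shows "v = 1"
proof -
  obtain w where w: "w * v = 1" using v_left_inverse sigma_eq_eps assms by blast
  have "w * (v * v) = w * v" using v_idempotent[OF assms] by simp
  then show ?thesis using w by (simp flip: mult.assoc)
qed

section \<open>The antipode and the bialgebra axiom\<close>

lemmas antip_simps = linear_functionalD[OF antip_morphism[unfolded yd_morphism_def, THEN conjunct1]]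
  linear_zero[OF antip_morphism[unfolded yd_morphism_def, THEN conjunct1]]

lemma multilinear_mul_antip: "multilinear (V1 B \<otimes> V1 B) (\<lambda>(x, y). mul B (antip B x) y)"
  by (intro multilinear_tensor multilinear_vs; simp add: B_distribs antip_simps)

lemma antip_one: "antip B (one B) = one B"
  using comul_sum[OF multilinear_mul_antip, of "one B"] antip_left[of "one B"]
  by (simp add: mul_one counit_simps phi_one antip_simps mul_simps linear_zero[OF mul_linear_left])

text \<open>
  The antipode axiom at \<open>n\<close> reads \<open>S(n) + n + \<kappa> S(n) n = 0\<close>.
\<close>

lemma antip_n: "antip B n = vscale B (\<phi> (antip B n)) n"
  and phi_antip_n: "\<phi> (antip B n) * (1 + \<kappa> * \<mu>) = - 1"
proof -
  have *: "antip B n + n + vscale B \<kappa> (mul B (antip B n) n) = 0"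
    using comul_sum[OF multilinear_mul_antip, of n] antip_left[of n]
    by (simp add: counit_simps phi_simps antip_simps mul_simps linear_zero[OF mul_linear_left]
       antip_one one_mul mul_one add.assoc)
  have c: "counit B (antip B n) = 0"
    using arg_cong[OF *, of "counit B"] by (simp add: counit_simps counit_zero)
  then show "antip B n = vscale B (\<phi> (antip B n)) n"
    by (intro coordinates_eqI) (simp_all add: counit_simps phi_simps)
  have "\<phi> (antip B n) + 1 + \<kappa> * (\<phi> (antip B n) * \<mu>) = 0"
    using arg_cong[OF *, of \<phi>] by (simp add: phi_simps phi_zero phi_mul c counit_n)
  then show "\<phi> (antip B n) * (1 + \<kappa> * \<mu>) = - 1"
    by (simp add: algebra_simps eq_neg_iff_add_eq_0)
qed

lemma antip_eq: "antip B x = vscale B (counit B x) (one B) + vscale B (\<phi> x * \<phi> (antip B n)) n"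
proof -
  have "antip B x = antip B (vscale B (counit B x) (one B) + vscale B (\<phi> x) n)"
    by (simp only: decomposition[symmetric])
  also have "\<dots> = vscale B (counit B x) (one B) + vscale B (\<phi> x) (vscale B (\<phi> (antip B n)) n)"
    by (simp add: antip_simps antip_one flip: antip_n)
  finally show ?thesis by simp
qed

definition weight :: "('h \<Rightarrow> 'k) \<Rightarrow> 'b \<Rightarrow> bool" where
  "weight f x \<longleftrightarrow> character (hscale H) f \<and> (\<forall>h. act B h x = vscale B (f h) x)"

lemma weight_one: "weight (eps H) (one B)"
  by (simp add: weight_def Q.eps one_act)

lemma weight_n: "weight \<sigma> (vscale B c n)"
  by (simp add: weight_def sigma_character act_n act_simps V.scale_scale mult.commute)

text \<open>
  The coefficient of \<open>n \<otimes> n\<close> in the braided product \<open>s t\<close>.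
\<close>

definition mul2_coeff :: "'b \<times> 'b \<Rightarrow> 'b \<times> 'b \<Rightarrow> 'k" where
  "mul2_coeff s t = (\<Sum>(x, y)\<leftarrow>mul2 H B s t. \<phi> x * \<phi> y)"

text \<open>
  The coefficient of \<open>n \<otimes> n\<close> that results from the part of the braided product that follows the
  braiding, at \<open>x \<otimes> ((z \<otimes> y) \<otimes> w)\<close>.  It is a separate function because it is multilinear, which
  allows the coaction inside the braiding to be evaluated.
\<close>

definition after_braiding :: "'b \<Rightarrow> 'b \<Rightarrow> 'b \<Rightarrow> 'b \<Rightarrow> 'k" where
  "after_braiding x z y w = (\<Sum>(z', y', w')\<leftarrow>assoc H B B B ((z, y), w). \<Sum>(y1, y2, y3)\<leftarrow>terms (PhiInv H).
    \<Sum>(y'', w'')\<leftarrow>act2 H B B y3 (y', w'). \<phi> (mul B (act B y1 x) (act B y2 z')) * \<phi> (mul B y'' w''))"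

lemma after_braiding_add:
  "after_braiding (x + x') z y w = after_braiding x z y w + after_braiding x' z y w"
  "after_braiding x (z + z') y w = after_braiding x z y w + after_braiding x z' y w"
  "after_braiding x z (y + y') w = after_braiding x z y w + after_braiding x z y' w"
  "after_braiding x z y (w + w') = after_braiding x z y w + after_braiding x z y w'"
  by (simp_all add: after_braiding_def assoc_def act2_def comp_def case_prod_unfold B_distribs)

lemma after_braiding_scale:
  "after_braiding (vscale B c x) z y w = c * after_braiding x z y w"
  "after_braiding x (vscale B c z) y w = c * after_braiding x z y w"
  "after_braiding x z (vscale B c y) w = c * after_braiding x z y w"
  "after_braiding x z y (vscale B c w) = c * after_braiding x z y w"
  unfolding after_braiding_def sum_list_const_mult[symmetric]
  by (simp_all add: assoc_def act2_def comp_def case_prod_unfold B_distribs flip: sum_list_const_mult)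

text \<open>
  The two summands are the components \<open>1 \<otimes> 1\<close> and \<open>v \<otimes> n\<close> of the coaction that the braiding applies
  to the second factor of \<open>x \<otimes> y\<close>.
\<close>

lemma mul2_coeff_eq:
  "mul2_coeff (x, y) (z, w) = (\<Sum>(X1, X2, X3)\<leftarrow>terms (Phi H). \<Sum>(z1, w1)\<leftarrow>act2 H B B X3 (z, w).
    \<Sum>(x1, x2, x3)\<leftarrow>terms (PhiInv H).
      counit B (act B x1 (act B X2 y)) * after_braiding (act B X1 x) (act B x2 z1) (one B) (act B x3 w1) +
      \<phi> (act B x1 (act B X2 y)) * after_braiding (act B X1 x) (act B v (act B x2 z1)) n (act B x3 w1))"
proof -
  have "(\<Sum>(g, m)\<leftarrow>terms (coact B b). after_braiding x' (act B g z') m w') =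
    counit B b * after_braiding x' z' (one B) w' + \<phi> b * after_braiding x' (act B v z') n w'" for b x' z' w'
  proof -
    have "multilinear (H1 H \<otimes> V1 B) (\<lambda>(g, m). after_braiding x' (act B g z') m w')"
      by (intro multilinear_tensor multilinear_vs; simp add: B_distribs after_braiding_add after_braiding_scale)
    from coact_sum[OF this] show ?thesis by (simp add: act_one after_braiding_scale)
  qed
  then show ?thesis
    by (simp add: mul2_coeff_def mul2_def sum_list_concat_map comp_def case_prod_unfold braiding_def
      after_braiding_def)
qed

lemma multilinear_mul2_coeff:
  "multilinear (V1 B \<otimes> V1 B) (\<lambda>s. mul2_coeff s t)"
  "multilinear (V1 B \<otimes> V1 B) (\<lambda>t. mul2_coeff s t)"
  by (cases s; cases t; intro multilinear_tensor multilinear_vs;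
    simp add: mul2_coeff_eq B_distribs act2_def comp_def after_braiding_add after_braiding_scale)+

lemma after_braiding_weight:
  assumes "weight f x" "weight g z" "weight l y" "weight k w"
  shows "after_braiding x z y w = eval3 (Phi H) g l k * eval3 (PhiInv H) f g (Q.conv l k) *
    (\<phi> (mul B x z) * \<phi> (mul B y w))"
  using assms
  by (simp only: after_braiding_def assoc_def act2_def eval3_def Q.conv_def comp_def case_prod_unfold weight_def
      list.map map_map sum_list_mult_const[symmetric] phi_simps mul_simps)
    (simp add: sum_list_const_mult[symmetric] mul_simps phi_simps act_simps mult_ac)

lemma mul2_coeff_one:
  assumes "weight f x" "weight g z" "weight k w"
  shows "mul2_coeff (x, one B) (z, w) = eval3 (Phi H) f (eps H) (Q.conv g k) * (eval3 (PhiInv H) (eps H) g k *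
    after_braiding x z (one B) w)"
  using assms
  by (simp only: mul2_coeff_eq act2_def eval3_def Q.conv_def comp_def case_prod_unfold weight_def
      list.map map_map sum_list_mult_const[symmetric])
    (simp add: sum_list_const_mult[symmetric] after_braiding_scale phi_act counit_simps act_simps phi_one mult_ac
      sum_list_swap[of _ "terms (PhiInv H)" "terms (Delta H h)" for h])

lemma mul2_coeff_n:
  assumes "weight f x" "weight g z" "weight k w"
  shows "mul2_coeff (x, n) (z, w) = eval3 (Phi H) f \<sigma> (Q.conv g k) * (eval3 (PhiInv H) \<sigma> g k *
    (g v * after_braiding x z n w))"
  using assms
  by (simp only: mul2_coeff_eq act2_def eval3_def Q.conv_def comp_def case_prod_unfold weight_def
      list.map map_map sum_list_mult_const[symmetric])
    (simp add: sum_list_const_mult[symmetric] after_braiding_scale phi_act counit_simps phi_n act_simps mult_ac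
      sum_list_swap[of _ "terms (PhiInv H)" "terms (Delta H h)" for h])

lemma weight_n': "weight \<sigma> n"
  using weight_n[of 1] by simp

text \<open>
  The coefficient of \<open>n \<otimes> n\<close> in \<open>\<Delta>(n\<^sup>2) = \<Delta>(n) \<Delta>(n)\<close>.
\<close>

lemma bialgebra_equation:
  "\<mu> * \<kappa> = (\<Sum>s\<leftarrow>[(n, one B), (one B, n), (vscale B \<kappa> n, n)]. \<Sum>t\<leftarrow>[(n, one B), (one B, n), (vscale B \<kappa> n, n)].
     mul2_coeff s t)"
proof -
  let ?u = "[(n, one B), (one B, n), (vscale B \<kappa> n, n)]"
  have ml: "multilinear (V1 B \<otimes> V1 B) (\<lambda>(x, y). \<phi> x * \<phi> y)"
    by (intro multilinear_tensor multilinear_vs; simp add: B_distribs)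
  have ml_sum: "multilinear (V1 B \<otimes> V1 B) (\<lambda>s. \<Sum>t\<leftarrow>?u. mul2_coeff s t)"
    using multilinear_mul2_coeff(1)
    by (intro multilinear_tensor multilinear_vs; simp add: multilinear_vs_tensorD[OF multilinear_mul2_coeff(1)] fst_vs)
  have "\<mu> * \<kappa> = (\<Sum>(x, y)\<leftarrow>terms (comul B (mul B n n)). \<phi> x * \<phi> y)"
    using comul_sum[OF ml] by (simp add: mul_n_n phi_simps phi_one)
  also have "\<dots> = (\<Sum>s\<leftarrow>terms (comul B n). \<Sum>t\<leftarrow>terms (comul B n). mul2_coeff s t)"
    using sum_terms[OF comul_mul ml]
    by (simp add: sum_list_concat_map comp_def mul2_coeff_def)
  also have "\<dots> = (\<Sum>s\<leftarrow>?u. \<Sum>t\<leftarrow>?u. mul2_coeff s t)"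
    using sum_terms[OF comul_n multilinear_mul2_coeff(2)] sum_terms[OF comul_n ml_sum] by simp
  finally show ?thesis .
qed

lemmas mul2_coeffs =
  mul2_coeff_one[OF weight_n' weight_n' weight_one] mul2_coeff_one[OF weight_n' weight_one weight_n']
  mul2_coeff_one[OF weight_n' weight_n weight_n']
  mul2_coeff_n[OF weight_one weight_n' weight_one] mul2_coeff_n[OF weight_one weight_one weight_n']
  mul2_coeff_n[OF weight_one weight_n weight_n']
  mul2_coeff_n[OF weight_n weight_n' weight_one] mul2_coeff_n[OF weight_n weight_one weight_n']
  mul2_coeff_n[OF weight_n weight_n weight_n']
  after_braiding_weight[OF weight_n' weight_n' weight_one weight_one]
  after_braiding_weight[OF weight_n' weight_one weight_one weight_n']
  after_braiding_weight[OF weight_n' weight_n weight_one weight_n']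
  after_braiding_weight[OF weight_one weight_n' weight_n' weight_one]
  after_braiding_weight[OF weight_one weight_one weight_n' weight_n']
  after_braiding_weight[OF weight_one weight_n weight_n' weight_n']
  after_braiding_weight[OF weight_n weight_n' weight_n' weight_one]
  after_braiding_weight[OF weight_n weight_one weight_n' weight_n']
  after_braiding_weight[OF weight_n weight_n weight_n' weight_n']

text \<open>
  A summand of \<open>bialgebra_equation\<close> is zero if it contains the factor \<open>n\<^sup>2 = 0\<close>, which leaves
  \<open>(n \<otimes> 1)(1 \<otimes> n)\<close> and \<open>(1 \<otimes> n)(n \<otimes> 1)\<close>.  In both, each value of a triple of characters at \<open>\<Phi>\<close> meets
  the value of the same triple at \<open>\<Phi>\<^sup>-\<^sup>1\<close>.  The first product thus contributes \<open>1\<close>, and the second one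
  \<open>\<sigma>(v)\<close> from the braiding.
\<close>

lemma nilpotent_case:
  assumes "\<mu> = 0" and char: "CHAR('k) \<noteq> 2"
  shows "\<sigma> v = - 1" and "\<kappa> = 0"
proof -
  note ev = Q.eval3_inverse[OF sigma_character Q.eps sigma_character]
    Q.eval3_inverse[OF Q.eps Q.eps sigma_character] Q.eval3_inverse[OF Q.eps sigma_character sigma_character]
    Q.eval3_inverse[OF sigma_character sigma_character Q.eps]
  have 1: "mul2_coeff (n, one B) (one B, n) = 1"
  proof -
    have "mul2_coeff (n, one B) (one B, n) =
      (eval3 (Phi H) \<sigma> (eps H) \<sigma> * eval3 (PhiInv H) \<sigma> (eps H) \<sigma>) *
      (eval3 (Phi H) (eps H) (eps H) \<sigma> * eval3 (PhiInv H) (eps H) (eps H) \<sigma>)"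
      by (simp add: mul2_coeffs Q.conv_eps sigma_character Q.eps mul_one one_mul phi_n mult_ac)
    then show ?thesis by (simp add: ev)
  qed
  have 2: "mul2_coeff (one B, n) (n, one B) = \<sigma> v"
  proof -
    have "mul2_coeff (one B, n) (n, one B) =
      (eval3 (Phi H) (eps H) \<sigma> \<sigma> * eval3 (PhiInv H) (eps H) \<sigma> \<sigma>) *
      (eval3 (Phi H) \<sigma> \<sigma> (eps H) * eval3 (PhiInv H) \<sigma> \<sigma> (eps H)) * \<sigma> v"
      by (simp add: mul2_coeffs Q.conv_eps sigma_character Q.eps mul_one one_mul phi_n mult_ac)
    then show ?thesis by (simp add: ev)
  qed
  have "0 = 1 + \<sigma> v"
    using bialgebra_equation 1 2
    by (simp add: assms) (simp add: mul2_coeffs phi_mul phi_simps phi_one counit_simps assms)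
  then show v: "\<sigma> v = - 1" by (simp add: eq_neg_iff_add_eq_0 add.commute)
  show "\<kappa> = 0"
  proof (rule ccontr)
    assume "\<kappa> \<noteq> 0"
    then have "(1::'k) = - 1" using sigma_eq_eps v eps_v by simp
    then have "(2::'k) = 0" by (simp add: eq_neg_iff_add_eq_0)
    then show False using two_nonzero[OF char] by simp
  qed
qed

text \<open>
  Here \<open>\<sigma> = \<epsilon>\<close>, so that \<open>bialgebra_equation\<close> is that of an ordinary bialgebra, namely
  \<open>x = 2 + 4 x + x\<^sup>2\<close> for \<open>x = \<kappa>\<mu>\<close>.  The root \<open>x = -1\<close> would leave \<open>S(n)\<close> without a solution.
\<close>

lemma idempotent_case:
  assumes "\<mu> \<noteq> 0"
  shows "\<kappa> * \<mu> = - 2" and "antip B n = n"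
proof -
  have eps: "\<sigma> = eps H" using sigma_eq_eps assms by simp
  have "(\<kappa> * \<mu> + 1) * (\<kappa> * \<mu> + 2) = 0"
    using bialgebra_equation
    by (simp add: mul2_coeffs eps Q.conv_eps Q.eps Q.eval3_eps phi_mul phi_simps phi_one counit_simps eps_v algebra_simps)
  then show *: "\<kappa> * \<mu> = - 2"
    using phi_antip_n by (auto simp: add.commute eq_neg_iff_add_eq_0)
  show "antip B n = n"
    using antip_n phi_antip_n by (simp add: *)
qed

section \<open>The two isomorphism types\<close>

lemma isomorphic_B_sigma_v:
  assumes "\<mu> = 0" and "\<kappa> = 0"
  shows "braided_hopf_isomorphic H B (B_sigma_v H \<sigma> v)"
proof -
  define s where "s = (\<lambda>c (x :: 'k, y :: 'k). (c * x, c * y))"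
  have s: "s c p = (c * fst p, c * snd p)" for c p by (simp add: s_def case_prod_unfold)
  let ?C = "B_sigma_v H \<sigma> v"
  have C: "vscale ?C = s" "act ?C h (x, y) = (eps H h * x, \<sigma> h * y)"
    "coact ?C (x, y) = cls (H1 H \<otimes> vs s) [(1, (x, 0)), (v, (0, y))]"
    "mul ?C (x, y) (x', y') = (x * x', x * y' + y * x')" "one ?C = (1, 0)"
    "comul ?C (x, y) = cls (vs s \<otimes> vs s) [((x, 0), (1, 0)), ((0, y), (1, 0)), ((1, 0), (0, y))]"
    "counit ?C (x, y) = x" "antip ?C (x, y) = (x, - y)" for h x y x' y'
    by (simp_all add: B_sigma_v_def s_def Let_def)
  have vector_space_s: "vector_space s" by unfold_locales (simp_all add: s algebra_simps)
  define f where "f b = (counit B b, \<phi> b)" for b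
  have f_add: "f (x + y) = f x + f y" and f_scale: "f (vscale B c x) = s c (f x)" for x y c
    by (simp_all add: f_def s counit_simps phi_simps)
  have f_basis: "f (one B) = (1, 0)" "f n = (0, 1)"
    by (simp_all add: f_def counit_simps phi_simps phi_one)
  interpret S: vector_space s by fact
  have f_linear: "Vector_Spaces.linear (vscale B) s f"
    by unfold_locales (simp_all add: f_add f_scale)
  have "bij f"
  proof (rule bijI)
    show "inj f" by (rule injI) (simp add: f_def coordinates_eqI)
    have "p = f (vscale B (fst p) (one B) + vscale B (snd p) n)" for p
      by (simp add: f_add f_scale f_basis s)
    then show "surj f" unfolding surj_def by blast
  qed
  moreover have "yd_morphism H B ?C f"
  proof -
    have "f (act B h m) = act ?C h (f m)" for h m
      by (simp add: f_def C counit_simps phi_act)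
    moreover have "coact ?C (f m) = cls (H1 H \<otimes> vs s) [(g, f m0). (g, m0) \<leftarrow> terms (coact B m)]" for m
      unfolding C f_def cls_eq_iff
    proof (rule teq_vs_tensorI[OF algebra_vector_space vector_space_s])
      fix F assume F: "Vector_Spaces.linear (hscale H) (*) F"
      note F_simps = linear_functionalD[OF F]
      have "multilinear (H1 H \<otimes> V1 B) (\<lambda>(g, m). s (F g) (f m))"
        by (intro multilinear_tensor multilinear_vs;
          simp add: F_simps f_add f_scale S.scale_right_distrib S.scale_left_distrib fst_vs mult.commute)
      from coact_sum[OF this, of m]
      show "(\<Sum>(x, y)\<leftarrow>[(1, (counit B m, 0)), (v, (0, \<phi> m))]. s (F x) y) =
        (\<Sum>(x, y)\<leftarrow>[(g, (counit B m0, \<phi> m0)). (g, m0) \<leftarrow> terms (coact B m)]. s (F x) y)"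
        by (simp add: comp_def case_prod_unfold f_def[symmetric]) (simp add: f_scale f_basis s)
    qed
    ultimately show ?thesis by (simp add: yd_morphism_def f_linear C)
  qed
  moreover have "f (mul B x y) = mul ?C (f x) (f y)" for x y
    by (simp add: f_def C counit_simps phi_mul assms)
  moreover have "comul ?C (f b) = cls (vs s \<otimes> vs s) [(f x, f y). (x, y) \<leftarrow> terms (comul B b)]" for b
    unfolding C f_def cls_eq_iff
  proof (rule teq_vs_tensorI[OF vector_space_s vector_space_s])
    fix F assume F: "Vector_Spaces.linear s (*) F"
    note F_simps = linear_functionalD[OF F]
    have F_pair: "F (x, y) = x * F (1, 0) + y * F (0, 1)" for x y
      using F_simps(1)[of "s x (1, 0)" "s y (0, 1)"] by (simp add: F_simps(2)) (simp add: s)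
    have "multilinear (V1 B \<otimes> V1 B) (\<lambda>(x, y). s (F (f x)) (f y))"
      by (intro multilinear_tensor multilinear_vs;
        simp add: F_simps f_add f_scale S.scale_right_distrib S.scale_left_distrib fst_vs mult.commute)
    from comul_sum[OF this, of b]
    show "(\<Sum>(x, y)\<leftarrow>[((counit B b, 0), (1, 0)), ((0, \<phi> b), (1, 0)), ((1, 0), (0, \<phi> b))]. s (F x) y) =
      (\<Sum>(x, y)\<leftarrow>[((counit B x, \<phi> x), (counit B y, \<phi> y)). (x, y) \<leftarrow> terms (comul B b)]. s (F x) y)"
      by (simp add: comp_def case_prod_unfold f_def[symmetric])
        (simp add: f_scale f_basis assms s F_pair[of "counit B b" 0] F_pair[of 0 "\<phi> b"]
          F_pair[of "\<phi> b" 0] linear_zero[OF F] linear_zero[OF f_linear])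
  qed
  moreover have "counit ?C (f b) = counit B b" for b by (simp add: f_def C)
  moreover have "f (antip B b) = antip ?C (f b)" for b
  proof -
    have "\<phi> (antip B n) = - 1" using phi_antip_n by (simp add: assms)
    then show ?thesis
      unfolding antip_eq[of b] by (simp only: f_def C) (simp only: counit_simps phi_simps phi_one, simp)
  qed
  ultimately show ?thesis
    unfolding braided_hopf_isomorphic_def braided_hopf_iso_def by (intro exI[of _ f]) (simp add: C f_basis)
qed

end

lemma UNIV_2: "(UNIV :: 2 set) = {0, 1}"
proof -
  have "card {0, 1 :: 2} = CARD(2)" by simp
  then show ?thesis by (metis card_subset_eq finite subset_UNIV)
qed

lemma eq_0_or_1: "(x :: 2) = 0 \<or> x = 1"
  using UNIV_2 by blast

lemma one_plus_one_2: "1 + 1 = (0 :: 2)"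
  by simp

context two_dimensional
begin

text \<open>
  In the basis \<open>1\<close>, \<open>g = 1 + \<kappa> n\<close> of \<open>B\<close> one has \<open>g\<^sup>2 = 1\<close>, \<open>\<Delta>(g) = g \<otimes> g\<close> and \<open>S(g) = g\<close>.
\<close>

lemma isomorphic_kC2:
  assumes "\<mu> \<noteq> 0" and char: "CHAR('k) \<noteq> 2"
  shows "braided_hopf_isomorphic H B (kC2 H)"
proof -
  note sigma = sigma_eq_eps[OF disjI1[OF assms(1)]]
  note v1 = v_eq_one[OF assms(1)]
  note al = idempotent_case[OF assms(1)]
  let ?l = "Poly_Mapping.lookup :: (2 \<Rightarrow>\<^sub>0 'k) \<Rightarrow> _"
  define s where "s = (\<lambda>c :: 'k. Poly_Mapping.map ((*) c) :: (2 \<Rightarrow>\<^sub>0 'k) \<Rightarrow> _)"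
  have s: "?l (s c p) g = c * ?l p g" for c p g
    by (simp add: s_def Poly_Mapping.map.rep_eq when_def)
  let ?C = "kC2 H"
  have vector_space_s: "vector_space s"
    by unfold_locales (rule poly_mapping_eqI, simp add: s lookup_add algebra_simps)+
  let ?e = "Poly_Mapping.single :: 2 \<Rightarrow> 'k \<Rightarrow> _"
  have eqI: "p = q" if "?l p 0 = ?l q 0" "?l p 1 = ?l q 1" for p q
  proof (rule poly_mapping_eqI)
    show "?l p g = ?l q g" for g
      using eq_0_or_1[of g] that by auto
  qed
  have expand: "p = ?e 0 (?l p 0) + ?e 1 (?l p 1)" for p
    by (rule eqI) (simp_all add: lookup_add lookup_single)
  have minus: "- x = x" for x :: 2 using eq_0_or_1[of x] by auto
  have C: "vscale ?C = s" "act ?C h = s (eps H h)" "coact ?C p = cls (H1 H \<otimes> vs s) [(1, p)]"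
    "mul ?C = (*)" "one ?C = 1"
    "comul ?C p = cls (vs s \<otimes> vs s) [(?e 0 (?l p 0), ?e 0 1), (?e 1 (?l p 1), ?e 1 1)]"
    "counit ?C p = ?l p 0 + ?l p 1" "antip ?C p = p" for h p
    using expand[of p] by (simp_all add: kC2_def s_def Let_def UNIV_2 minus)
  have \<kappa>: "\<kappa> \<noteq> 0" using al(1) two_nonzero[OF char] by auto
  have \<mu>: "\<mu> = - 2 / \<kappa>" using al(1) \<kappa> by (simp add: field_simps)
  interpret S: vector_space s by fact
  \<comment> \<open>The coordinates of \<open>b\<close> with respect to \<open>1\<close> and \<open>1 + \<kappa> n\<close>, as \<open>n = (g - 1) / \<kappa>\<close>.\<close>
  define f where "f b = ?e 0 (counit B b - \<phi> b / \<kappa>) + ?e 1 (\<phi> b / \<kappa>)" for b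
  have f_lookup: "?l (f b) 0 = counit B b - \<phi> b / \<kappa>" "?l (f b) 1 = \<phi> b / \<kappa>" for b
    by (simp_all add: f_def lookup_add lookup_single)
  have f_add: "f (x + y) = f x + f y" and f_scale: "f (vscale B c x) = s c (f x)" for x y c
    by (rule eqI; simp add: f_lookup s lookup_add counit_simps phi_simps algebra_simps add_divide_distrib)+
  have f_linear: "Vector_Spaces.linear (vscale B) s f"
    by unfold_locales (simp_all add: f_add f_scale)
  have f_one: "f (one B) = 1"
    by (simp add: f_def counit_simps phi_one single_one)
  have "bij f"
  proof (rule bijI)
    show "inj f"
    proof (rule injI)
      fix x y assume "f x = f y"
      then have "counit B x - \<phi> x / \<kappa> = counit B y - \<phi> y / \<kappa>" "\<phi> x / \<kappa> = \<phi> y / \<kappa>"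
        by (metis f_lookup(1)) (metis \<open>f x = f y\<close> f_lookup(2))
      then show "x = y" using \<kappa> by (intro coordinates_eqI) auto
    qed
    have "p = f (vscale B (?l p 0 + ?l p 1) (one B) + vscale B (\<kappa> * ?l p 1) n)" for p
      using \<kappa> by (intro eqI) (simp_all add: f_lookup counit_simps phi_simps phi_one)
    then show "surj f" unfolding surj_def by blast
  qed
  moreover have "yd_morphism H B ?C f"
  proof -
    have "f (act B h m) = act ?C h (f m)" for h m
      by (rule eqI) (simp_all add: f_lookup C s counit_simps phi_act sigma algebra_simps)
    moreover have "coact ?C (f m) = cls (H1 H \<otimes> vs s) [(g, f m0). (g, m0) \<leftarrow> terms (coact B m)]" for m
      unfolding C cls_eq_iff
    proof (rule teq_vs_tensorI[OF algebra_vector_space vector_space_s])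
      fix F assume F: "Vector_Spaces.linear (hscale H) (*) F"
      note F_simps = linear_functionalD[OF F]
      have "multilinear (H1 H \<otimes> V1 B) (\<lambda>(g, m). s (F g) (f m))"
        by (intro multilinear_tensor multilinear_vs;
          simp add: F_simps f_add f_scale S.scale_right_distrib S.scale_left_distrib fst_vs mult.commute)
      from coact_sum[OF this, of m]
      have "(\<Sum>(g, m)\<leftarrow>terms (coact B m). s (F g) (f m)) =
          s (F 1) (f (vscale B (counit B m) (one B) + vscale B (\<phi> m) n))"
        by (simp add: v1 f_add S.scale_right_distrib)
      then show "(\<Sum>(x, y)\<leftarrow>[(1, f m)]. s (F x) y) =
        (\<Sum>(x, y)\<leftarrow>[(g, f m0). (g, m0) \<leftarrow> terms (coact B m)]. s (F x) y)"
        by (simp add: comp_def case_prod_unfold flip: decomposition)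
    qed
    ultimately show ?thesis by (simp add: yd_morphism_def f_linear C(1))
  qed
  moreover have "f (mul B x y) = mul ?C (f x) (f y)" for x y
  proof -
    have "f x * f y = ?e 0 ((counit B x - \<phi> x / \<kappa>) * (counit B y - \<phi> y / \<kappa>) + \<phi> x / \<kappa> * (\<phi> y / \<kappa>)) +
        ?e 1 ((counit B x - \<phi> x / \<kappa>) * (\<phi> y / \<kappa>) + \<phi> x / \<kappa> * (counit B y - \<phi> y / \<kappa>))"
      unfolding f_def distrib_left distrib_right mult_single by (simp add: single_add ac_simps one_plus_one_2 del: one_add_one)
    then show ?thesis
      using \<kappa> by (intro eqI)
        (simp_all add: C f_lookup lookup_add lookup_single counit_simps phi_mul \<mu> field_simps)
  qed
  moreover have "comul ?C (f b) = cls (vs s \<otimes> vs s) [(f x, f y). (x, y) \<leftarrow> terms (comul B b)]" for b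
    unfolding C cls_eq_iff
  proof (rule teq_vs_tensorI[OF vector_space_s vector_space_s])
    fix F assume F: "Vector_Spaces.linear s (*) F"
    note F_simps = linear_functionalD[OF F]
    have single: "?e i x = s x (?e i 1)" for i x
      by (rule eqI) (simp_all add: s lookup_single when_def)
    have F_single: "F (?e i x) = x * F (?e i 1)" for i x
      by (subst single) (simp add: F_simps)
    have F_f: "F (f x) = (counit B x - \<phi> x / \<kappa>) * F (?e 0 1) + \<phi> x / \<kappa> * F (?e 1 1)" for x
      unfolding f_def F_simps(1) by (subst (1 2) F_single) simp
    have "multilinear (V1 B \<otimes> V1 B) (\<lambda>(x, y). s (F (f x)) (f y))"
      by (intro multilinear_tensor multilinear_vs;
        simp add: F_simps f_add f_scale S.scale_right_distrib S.scale_left_distrib fst_vs mult.commute)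
    note right = comul_sum[OF this, of b]
    have "(\<Sum>(x, y)\<leftarrow>[(?e 0 (?l (f b) 0), ?e 0 1), (?e 1 (?l (f b) 1), ?e 1 1)]. s (F x) y) =
      s (?l (f b) 0 * F (?e 0 1)) (?e 0 1) + s (?l (f b) 1 * F (?e 1 1)) (?e 1 1)"
      by (simp add: F_single[of 0 "?l (f b) 0"] F_single[of 1 "?l (f b) 1"] del: single_one)
    also have "\<dots> = (\<Sum>(x, y)\<leftarrow>terms (comul B b). s (F (f x)) (f y))"
      unfolding right using \<kappa>
      by (intro eqI) (simp_all add: s lookup_add f_lookup F_f lookup_single counit_simps phi_simps phi_one
        field_simps del: single_one)
    finally show "(\<Sum>(x, y)\<leftarrow>[(?e 0 (?l (f b) 0), ?e 0 1), (?e 1 (?l (f b) 1), ?e 1 1)]. s (F x) y) =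
      (\<Sum>(x, y)\<leftarrow>[(f x, f y). (x, y) \<leftarrow> terms (comul B b)]. s (F x) y)"
      by (simp add: comp_def case_prod_unfold)
  qed
  moreover have "counit ?C (f b) = counit B b" for b by (simp add: f_lookup C)
  moreover have "f (antip B b) = antip ?C (f b)" for b
    by (simp add: C antip_eq[of b] al phi_n flip: decomposition)
  ultimately show ?thesis
    unfolding braided_hopf_isomorphic_def braided_hopf_iso_def by (intro exI[of _ f]) (simp add: C f_one)
qed

end

text \<open>
  Complete the unit to a basis \<open>1, m\<close>; then \<open>n = m - \<epsilon>(m) 1\<close>, and \<open>\<phi>\<close> is the coordinate of \<open>m\<close>.
\<close>

lemma two_dimensional_exists:
  assumes "quasi_hopf_algebra H" and "braided_hopf_algebra H B"
    and dim: "vector_space.dim (vscale B) UNIV = 2"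
  shows "\<exists>n \<phi>. two_dimensional H B n \<phi>"
proof -
  interpret quasi_hopf_algebra H by fact
  interpret B: braided_hopf_algebra H B by fact
  interpret V: vector_space "vscale B" by (rule B.vector_space)
  note counit = linear_functionalD[OF B.counit_linear]
  have "one B \<noteq> 0" using B.counit_one linear_zero[OF B.counit_linear] by auto
  then have ind: "V.independent {one B}" by (simp add: V.independent_insert V.independent_empty)
  define E where "E = V.extend_basis {one B}"
  have E: "V.independent E" "V.span E = UNIV" "one B \<in> E"
    using V.independent_extend_basis[OF ind] V.span_extend_basis[OF ind] V.extend_basis_superset[OF ind]
    by (auto simp: E_def)
  have "card E = 2" using V.dim_eq_card[of E UNIV] E dim by simp
  then obtain m where m: "E = {one B, m}" "m \<noteq> one B"
    using E(3) by (metis card_2_iff doubleton_eq_iff insert_iff singletonD)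
  define \<phi> where "\<phi> b = V.representation E b m" for b
  define n where "n = m - vscale B (counit B m) (one B)"
  have phi: "\<phi> (x + y) = \<phi> x + \<phi> y" "\<phi> (vscale B c x) = c * \<phi> x" for x y c
    using E by (simp_all add: \<phi>_def V.representation_add V.representation_scale)
  have phi_basis: "\<phi> m = 1" "\<phi> (one B) = 0"
    using E m by (simp_all add: \<phi>_def V.representation_basis)
  have lin: "Vector_Spaces.linear (vscale B) (*) \<phi>"
    by unfold_locales (simp_all add: phi algebra_simps)
  have "b = vscale B (counit B b) (one B) + vscale B (\<phi> b) n" for b
  proof -
    define c where "c = V.representation E b (one B)"
    have "b = (\<Sum>e\<in>E. vscale B (V.representation E b e) e)"
      using V.sum_representation_eq[of E b E] E m by simp
    then have b: "b = vscale B c (one B) + vscale B (\<phi> b) m"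
      using m by (simp add: c_def \<phi>_def)
    have "counit B b = c + \<phi> b * counit B m"
      using arg_cong[OF b, of "counit B"] by (simp add: counit B.counit_one)
    with b show ?thesis
      by (simp add: n_def V.scale_right_diff_distrib V.scale_left_distrib)
  qed
  moreover have "counit B n = 0"
    using counit(1)[of n "vscale B (counit B m) (one B)"] by (simp add: n_def counit B.counit_one)
  moreover have "\<phi> n = 1"
    using phi(1)[of n "vscale B (counit B m) (one B)"] by (simp add: n_def phi phi_basis)
  ultimately have "two_dimensional H B n \<phi>"
    using lin assms by (simp add: two_dimensional_def two_dimensional_axioms_def)
  then show ?thesis by blast
qed

theorem theorem2p6:
  fixes H :: "('k::field, 'h::ring_1) quasi_hopf"
    and B :: "('k, 'h, 'b::ab_group_add) braided_hopf"
  assumes "CHAR('k) \<noteq> 2"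
    and "quasi_hopf_algebra H"
    and "bij (antipode H)"
    and "braided_hopf_algebra H B"
    and "vector_space.dim (vscale B) UNIV = 2"
  shows
    "(\<exists>\<sigma> v.
        character (hscale H) \<sigma> \<and> \<sigma> v = -1 \<and> eps H v = 1 \<and>
        Delta H v =
          cls (H1 H \<otimes> H1 H)
            [(hscale H (\<sigma> (x3 * X2 * y1)) (x1 * X1 * v * y2), x2 * v * X3 * y3).
               (x1, x2, x3) \<leftarrow> terms (PhiInv H), (X1, X2, X3) \<leftarrow> terms (Phi H),
               (y1, y2, y3) \<leftarrow> terms (PhiInv H)] \<and>
        (\<forall>h. (\<Sum>(h1, h2)\<leftarrow>terms (Delta H h). hscale H (\<sigma> h2) (h1 * v)) =
             (\<Sum>(h1, h2)\<leftarrow>terms (Delta H h). hscale H (\<sigma> h1) (v * h2))) \<and>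
        braided_hopf_isomorphic H B (B_sigma_v H \<sigma> v)) \<or>
     braided_hopf_isomorphic H B (kC2 H)"
proof -
  obtain n \<phi> where "two_dimensional H B n \<phi>" using two_dimensional_exists assms by blast
  then interpret two_dimensional H B n \<phi> .
  show ?thesis
  proof (cases "\<mu> = 0")
    case True
    note nil = nilpotent_case[OF True assms(1)]
    show ?thesis
      using sigma_character nil(1) eps_v Delta_v sigma_v_commute isomorphic_B_sigma_v[OF True nil(2)]
      by (intro disjI1 exI[of _ \<sigma>] exI[of _ v]) simp
  next
    case False
    then show ?thesis using isomorphic_kC2 assms(1) by blast
  qed
qed

end
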